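(* Let $A\in\mathbb{C}^{n\times n}$ be Hermitian positive semi-definite with eigenvalue decomposition $A=U\Lambda U^*$, $U$ unitary, $\Lambda=\mathrm{diag}(\lambda_1,\dots,\lambda_n)$, $\lambda_1\ge\cdots\ge\lambda_n$, and let $k$ satisfy $\lambda_k>\lambda_{k+1}>0$. Partition $U=(U_1,U_2)$ with $U_1\in\mathbb{C}^{n\times k}$ and let $\Lambda_2=\mathrm{diag}(\lambda_{k+1},\dots,\lambda_n)$. Let $q\ge1$, $k\le l\le n$, and let $\Omega\in\mathbb{C}^{n\times l}$ be any matrix such that $\widehat\Omega_1=U_1^*\Omega$ has rank $k$ and $K_q=(A\Omega,A^2\Omega,\dots,A^q\Omega)$ has full column rank $ql$. Let $\widehat\Omega_2=U_2^*\Omega$, let $K_q=Q_qR_q$ be the thin QR factorization and $T=Q_q^*AQ_q\in\mathbb{C}^{ql\times ql}$. Then $$0\le\log\det(I_n+A)-\log\det(I_{ql}+T)\le\log\det(I_{n-k}+\eta\Lambda_2)+\log\det(I_{n-k}+\Lambda_2),$$ where $\eta=\frac{\lambda_{k+1}}{\lambda_k}T_{q-1}^{-2}\!\left(\frac{2\lambda_k-\lambda_{k+1}}{\lambda_{k+1}}\right)\|\widehat\Omega_2\widehat\Omega_1^\dagger\|_2^2$.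
   Context: $X^\dagger$ denotes the Moore–Penrose inverse and $\|\cdot\|_2$ the spectral norm. $T_m$ is the Chebyshev polynomial of the first kind of degree $m$; for $x\ge1$, $T_m(x)=\frac{(x+\sqrt{x^2-1})^m+(x-\sqrt{x^2-1})^m}{2}$, and $T_m^{-2}(x)=1/T_m(x)^2$. *)

theory Defs
  imports "Jordan_Normal_Form.Schur_Decomposition" "Jordan_Normal_Form.DL_Rank"
begin

definition hermitian_mat :: "complex mat \<Rightarrow> bool" where
  "hermitian_mat A \<longleftrightarrow> square_mat A \<and> mat_adjoint A = A"

definition psd_mat :: "complex mat \<Rightarrow> bool" where
  "psd_mat A \<longleftrightarrow> hermitian_mat A \<and>
     (\<forall>v \<in> carrier_vec (dim_row A). Re ((A *\<^sub>v v) \<bullet>c v) \<ge> 0)"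

definition unitary_mat :: "complex mat \<Rightarrow> bool" where
  "unitary_mat U \<longleftrightarrow> square_mat U \<and> mat_adjoint U * U = 1\<^sub>m (dim_row U)
      \<and> U * mat_adjoint U = 1\<^sub>m (dim_row U)"

definition rdiag :: "nat \<Rightarrow> (nat \<Rightarrow> real) \<Rightarrow> complex mat" where
  "rdiag m d = mat m m (\<lambda>(i,j). if i = j then complex_of_real (d i) else 0)"

definition pinv :: "complex mat \<Rightarrow> complex mat" where
  "pinv M = (THE X. X \<in> carrier_mat (dim_col M) (dim_row M) \<and>
      M * X * M = M \<and> X * M * X = X \<and>
      mat_adjoint (M * X) = M * X \<and> mat_adjoint (X * M) = X * M)"

definition vnorm2 :: "complex vec \<Rightarrow> real" where
  "vnorm2 v = sqrt (Re (v \<bullet>c v))"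

definition spec_norm :: "complex mat \<Rightarrow> real" where
  "spec_norm M = Sup {vnorm2 (M *\<^sub>v v) | v. v \<in> carrier_vec (dim_col M) \<and> vnorm2 v = 1}"

fun cheb :: "nat \<Rightarrow> real \<Rightarrow> real" where
  "cheb 0 x = 1"
| "cheb (Suc 0) x = x"
| "cheb (Suc (Suc m)) x = 2 * x * cheb (Suc m) x - cheb m x"

text \<open>Block Krylov matrix (A \<Omega>, A^2 \<Omega>, ..., A^q \<Omega>), of size n x (q l).\<close>
definition krylov :: "complex mat \<Rightarrow> complex mat \<Rightarrow> nat \<Rightarrow> complex mat" where
  "krylov A \<Omega> q = mat (dim_row A) (q * dim_col \<Omega>)
     (\<lambda>(i,j). (A ^\<^sub>m (j div dim_col \<Omega> + 1) * \<Omega>) $$ (i, j mod dim_col \<Omega>))"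

definition first_cols :: "complex mat \<Rightarrow> nat \<Rightarrow> complex mat" where
  "first_cols U k = mat (dim_row U) k (\<lambda>(i,j). U $$ (i, j))"

definition last_cols :: "complex mat \<Rightarrow> nat \<Rightarrow> complex mat" where
  "last_cols U k = mat (dim_row U) (dim_col U - k) (\<lambda>(i,j). U $$ (i, j + k))"

definition logdet_id_plus :: "complex mat \<Rightarrow> real" where
  "logdet_id_plus M = ln (Re (det (1\<^sub>m (dim_row M) + M)))"

end

theory Submission
  imports Defs "HOL-Analysis.L2_Norm"
begin

text \<open>Write \<open>A = S S\<^sup>*\<close>, so that \<open>det (1 + T) = det (1 + S\<^sup>* Q Q\<^sup>* S)\<close>; the lower bound is monotonicity of
  the determinant. Since \<open>det (1 + X + Y) \<le> det (1 + X) det (1 + Y)\<close> for positive semi-definite matrices,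
  the upper bound reduces to an estimate of \<open>S\<^sup>* (1 - Q Q\<^sup>*) S\<close>. The range of \<open>Q\<close> contains the columns of
  \<open>\<phi>(A) \<Omega> \<Omega>\<^sub>1\<^sup>\<dagger> \<phi>(\<Lambda>\<^sub>1)\<^sup>-\<^sup>1 = U (1; F)\<close>, where \<open>F = \<phi>(\<Lambda>\<^sub>2) \<Omega>\<^sub>2 \<Omega>\<^sub>1\<^sup>\<dagger> \<phi>(\<Lambda>\<^sub>1)\<^sup>-\<^sup>1\<close> and \<open>\<phi>(t)\<close> is \<open>t\<close> times a
  shifted Chebyshev polynomial, and hence its orthogonal complement lies in the range of \<open>Y = U (-F\<^sup>*; 1)\<close>, which
  gives \<open>1 - Q Q\<^sup>* \<le> Y Y\<^sup>*\<close>. It remains to bound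
  \<open>det (1 + Y\<^sup>* A Y) = det (1 + F \<Lambda>\<^sub>1 F\<^sup>* + \<Lambda>\<^sub>2) \<le> det (1 + F \<Lambda>\<^sub>1 F\<^sup>*) det (1 + \<Lambda>\<^sub>2)\<close>, and
  \<open>F \<Lambda>\<^sub>1 F\<^sup>* \<le> \<eta> \<Lambda>\<^sub>2\<close> because \<open>\<phi>(t)\<^sup>2 / t\<close> is at least its value at \<open>\<lambda>\<^sub>k\<close> for \<open>t \<ge> \<lambda>\<^sub>k\<close> and \<open>\<phi>(t)\<^sup>2 \<le> \<lambda>\<^sub>k\<^sub>+\<^sub>1 t\<close> for
  \<open>0 \<le> t \<le> \<lambda>\<^sub>k\<^sub>+\<^sub>1\<close>.\<close>

subsection \<open>Adjoints and Hermitian forms\<close>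

lemma mat_adjoint_eq: "mat_adjoint (M :: complex mat) = mat (dim_col M) (dim_row M) (\<lambda>(i,j). cnj (M $$ (j,i)))"
  by (rule eq_matI) (auto simp: mat_adjoint_def mat_of_rows_def conjugate_complex_def)

lemma mat_adjoint_dim [simp]:
  "dim_row (mat_adjoint (M :: complex mat)) = dim_col M" "dim_col (mat_adjoint M) = dim_row M"
  by (auto simp: mat_adjoint_eq)

lemma mat_adjoint_index [simp]:
  "i < dim_col M \<Longrightarrow> j < dim_row M \<Longrightarrow> mat_adjoint (M :: complex mat) $$ (i,j) = cnj (M $$ (j,i))"
  by (auto simp: mat_adjoint_eq)

lemma mat_adjoint_carrier [simp, intro]:
  "M \<in> carrier_mat m n \<Longrightarrow> mat_adjoint (M :: complex mat) \<in> carrier_mat n m"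
  by auto

lemma mat_adjoint_adjoint [simp]: "mat_adjoint (mat_adjoint M) = (M :: complex mat)"
  by (rule eq_matI) auto

lemma mult_mat_index:
  "i < dim_row M \<Longrightarrow> j < dim_col N \<Longrightarrow> dim_row N = dim_col M \<Longrightarrow>
   (M * N) $$ (i,j) = (\<Sum>h<dim_col M. M $$ (i,h) * N $$ (h,j))"
  by (auto simp: scalar_prod_def atLeast0LessThan intro!: sum.cong)

lemma mult_vec_index:
  "i < dim_row M \<Longrightarrow> dim_vec v = dim_col M \<Longrightarrow> (M *\<^sub>v v) $ i = (\<Sum>h<dim_col M. M $$ (i,h) * v $ h)"
  by (auto simp: scalar_prod_def atLeast0LessThan intro!: sum.cong)

lemma cscalar_sum: "dim_vec w = n \<Longrightarrow> v \<bullet>c w = (\<Sum>i<n. v $ i * cnj (w $ i))" for v w :: "complex vec"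
  by (auto simp: scalar_prod_def atLeast0LessThan conjugate_complex_def intro!: sum.cong)

lemma mat_adjoint_mult:
  fixes M N :: "complex mat"
  assumes "M \<in> carrier_mat a b" "N \<in> carrier_mat b c"
  shows "mat_adjoint (M * N) = mat_adjoint N * mat_adjoint M"
  using assms by (intro eq_matI) (auto simp: mult_mat_index mult.commute simp del: index_mult_mat(1))

lemma mat_adjoint_one [simp]: "mat_adjoint (1\<^sub>m n :: complex mat) = 1\<^sub>m n"
  by (rule eq_matI) auto

lemma mat_adjoint_add:
  "M \<in> carrier_mat a b \<Longrightarrow> N \<in> carrier_mat a b \<Longrightarrow>
    mat_adjoint (M + N) = mat_adjoint M + mat_adjoint (N :: complex mat)"
  by (rule eq_matI) auto

lemma mat_adjoint_minus:
  "M \<in> carrier_mat a b \<Longrightarrow> N \<in> carrier_mat a b \<Longrightarrow>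
    mat_adjoint (M - N) = mat_adjoint M - mat_adjoint (N :: complex mat)"
  by (rule eq_matI) auto

lemma cscalar_adjoint:
  fixes M :: "complex mat"
  assumes "M \<in> carrier_mat a b" "v \<in> carrier_vec b" "w \<in> carrier_vec a"
  shows "(M *\<^sub>v v) \<bullet>c w = v \<bullet>c (mat_adjoint M *\<^sub>v w)"
proof -
  have "(M *\<^sub>v v) \<bullet>c w = (\<Sum>i<a. \<Sum>j<b. M $$ (i,j) * v $ j * cnj (w $ i))"
    using assms by (auto simp: cscalar_sum[of w a] mult_vec_index sum_distrib_right simp del: index_mult_mat_vec)
  also have "\<dots> = (\<Sum>j<b. \<Sum>i<a. M $$ (i,j) * v $ j * cnj (w $ i))"
    by (rule sum.swap)
  also have "\<dots> = v \<bullet>c (mat_adjoint M *\<^sub>v w)"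
    using assms by (auto simp: cscalar_sum[of _ b] mult_vec_index sum_distrib_left ac_simps
        simp del: index_mult_mat_vec intro!: sum.cong)
  finally show ?thesis .
qed

text \<open>Squared norms are kept as real numbers, so that order arguments need neither
  \<open>Re\<close> nor square roots.\<close>

definition nsq :: "complex vec \<Rightarrow> real" where
  "nsq v = (\<Sum>i<dim_vec v. (cmod (v $ i))\<^sup>2)"

lemma cscalar_self: "v \<bullet>c v = complex_of_real (nsq v)"
  by (simp add: cscalar_sum[of v "dim_vec v"] nsq_def complex_norm_square del: of_real_power)

lemma nsq_nonneg [simp]: "0 \<le> nsq v"
  by (simp add: nsq_def sum_nonneg)

lemma nsq_pos: "v \<in> carrier_vec n \<Longrightarrow> v \<noteq> 0\<^sub>v n \<Longrightarrow> 0 < nsq v"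
proof -
  assume v: "v \<in> carrier_vec n" "v \<noteq> 0\<^sub>v n"
  hence "v \<bullet>c v \<noteq> 0" using conjugate_square_eq_0_vec by blast
  thus ?thesis using nsq_nonneg[of v] by (simp add: cscalar_self del: nsq_nonneg)
qed

lemma nsq_eq_0: "v \<in> carrier_vec n \<Longrightarrow> nsq v = 0 \<Longrightarrow> v = 0\<^sub>v n"
  using nsq_pos by fastforce

lemma vnorm2_eq: "vnorm2 v = sqrt (nsq v)"
  by (simp add: vnorm2_def cscalar_self)

lemma cscalar_cauchy_schwarz:
  fixes v w :: "complex vec"
  assumes "v \<in> carrier_vec n" "w \<in> carrier_vec n"
  shows "cmod (v \<bullet>c w) \<le> sqrt (nsq v) * sqrt (nsq w)"
proof -
  have "cmod (v \<bullet>c w) \<le> (\<Sum>i<n. \<bar>cmod (v $ i)\<bar> * \<bar>cmod (w $ i)\<bar>)"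
    using assms by (auto simp: cscalar_sum[of w n] intro: order_trans[OF norm_sum] simp: norm_mult)
  also have "\<dots> \<le> L2_set (\<lambda>i. cmod (v $ i)) {..<n} * L2_set (\<lambda>i. cmod (w $ i)) {..<n}"
    by (rule L2_set_mult_ineq)
  finally show ?thesis using assms by (auto simp: L2_set_def nsq_def)
qed

text \<open>Moving \<open>M\<close> to the other argument turns the form into its own complex
  conjugate.\<close>

lemma hermitian_form_real:
  fixes M :: "complex mat"
  assumes "M \<in> carrier_mat n n" "mat_adjoint M = M" "v \<in> carrier_vec n"
  shows "(M *\<^sub>v v) \<bullet>c v = complex_of_real (Re ((M *\<^sub>v v) \<bullet>c v))"
proof -
  have "(M *\<^sub>v v) \<bullet>c v = v \<bullet>c (M *\<^sub>v v)"
    using cscalar_adjoint[of M n n v v] assms by simp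
  also have "\<dots> = cnj ((M *\<^sub>v v) \<bullet>c v)"
    using assms by (auto simp: cscalar_sum[of _ n] mult.commute)
  finally have "(M *\<^sub>v v) \<bullet>c v = cnj ((M *\<^sub>v v) \<bullet>c v)" .
  thus ?thesis by (metis Reals_cnj_iff of_real_Re)
qed

text \<open>One factor moves across the inner product as an adjoint. Positive matrices are mostly
  written as Gram matrices below, so that comparing their forms means comparing squared
  norms.\<close>

lemma psd_gram:
  fixes M :: "complex mat"
  assumes "M \<in> carrier_mat a b"
  shows "psd_mat (M * mat_adjoint M)" 
    and "v \<in> carrier_vec a \<Longrightarrow> Re (((M * mat_adjoint M) *\<^sub>v v) \<bullet>c v) = nsq (mat_adjoint M *\<^sub>v v)"
proof -
  show *: "Re (((M * mat_adjoint M) *\<^sub>v v) \<bullet>c v) = nsq (mat_adjoint M *\<^sub>v v)" if "v \<in> carrier_vec a" for v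
    using cscalar_adjoint[of M a b "mat_adjoint M *\<^sub>v v" v] mat_adjoint_carrier[OF assms] assms that
    by (simp add: assoc_mult_mat_vec[of _ a b _ a] cscalar_self)
  show "psd_mat (M * mat_adjoint M)"
    using assms * by (auto simp: psd_mat_def hermitian_mat_def mat_adjoint_mult[of M a b _ a])
qed

lemma form_add:
  fixes M N :: "complex mat"
  assumes "M \<in> carrier_mat n n" "N \<in> carrier_mat n n" "v \<in> carrier_vec n"
  shows "((M + N) *\<^sub>v v) \<bullet>c v = (M *\<^sub>v v) \<bullet>c v + (N *\<^sub>v v) \<bullet>c v"
  using assms by (simp add: add_mult_distrib_mat_vec add_scalar_prod_distrib[of _ n])

lemma form_minus:
  fixes M N :: "complex mat"
  assumes "M \<in> carrier_mat n n" "N \<in> carrier_mat n n" "v \<in> carrier_vec n"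
  shows "((M - N) *\<^sub>v v) \<bullet>c v = (M *\<^sub>v v) \<bullet>c v - (N *\<^sub>v v) \<bullet>c v"
  using assms by (simp add: minus_mult_distrib_mat_vec minus_scalar_prod_distrib[of _ n])

subsection \<open>Determinants of positive semi-definite matrices\<close>

text \<open>Sylvester's determinant identity. The same unipotent factor, placed on the right or on
  the left, makes \<open>?B\<close> block upper triangular; the diagonal blocks are then
  \<open>1 + M N\<close> and \<open>1\<close>, or \<open>1\<close> and \<open>1 + N M\<close>, and
  both products have the same determinant.\<close>

lemma det_one_plus_mult_commute:
  fixes M N :: "complex mat"
  assumes M: "M \<in> carrier_mat a b" and N: "N \<in> carrier_mat b a"
  shows "det (1\<^sub>m a + M * N) = det (1\<^sub>m b + N * M)"
proof -
  let ?B = "four_block_mat (1\<^sub>m a) (- M) N (1\<^sub>m b)"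
  have "?B * four_block_mat (1\<^sub>m a) (0\<^sub>m a b) (-N) (1\<^sub>m b) =
      four_block_mat (1\<^sub>m a + M * N) (-M) (0\<^sub>m b a) (1\<^sub>m b)"
    using M N by (subst mult_four_block_mat[of _ a a _ b _ b _ _ a _ b]) 
      (auto intro!: arg_cong2[where f = "\<lambda>x y. four_block_mat x (-M) y (1\<^sub>m b)"])
  moreover have "four_block_mat (1\<^sub>m a) (0\<^sub>m a b) (-N) (1\<^sub>m b) * ?B =
      four_block_mat (1\<^sub>m a) (-M) (0\<^sub>m b a) (1\<^sub>m b + N * M)"
    using M N by (subst mult_four_block_mat[of _ a a _ b _ b _ _ a _ b]) 
      (auto simp: comm_add_mat[of _ b b] intro!: arg_cong2[where f = "\<lambda>x y. four_block_mat (1\<^sub>m a) (-M) x y"])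
  moreover have "det (?B * four_block_mat (1\<^sub>m a) (0\<^sub>m a b) (-N) (1\<^sub>m b)) =
     det (four_block_mat (1\<^sub>m a) (0\<^sub>m a b) (-N) (1\<^sub>m b) * ?B)"
    using M N by (subst (1 2) det_mult[of _ "a+b"]) auto
  ultimately show ?thesis using M N 
    by (simp add: det_four_block_mat_lower_left_zero[of _ a _ b])
qed

lemma det_invertible:
  fixes M :: "complex mat"
  assumes "M \<in> carrier_mat n n" "det M \<noteq> 0"
  obtains Mi where "Mi \<in> carrier_mat n n" "M * Mi = 1\<^sub>m n" "Mi * M = 1\<^sub>m n"
proof -
  have "M \<in> Units (ring_mat TYPE(complex) n ())"
    using det_non_zero_imp_unit[OF assms] .
  thus ?thesis using that by (auto simp: Units_def ring_mat_simps)
qed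

lemma det_nonzero_if_injective:
  fixes M :: "complex mat"
  assumes "M \<in> carrier_mat n n" "\<And>v. v \<in> carrier_vec n \<Longrightarrow> M *\<^sub>v v = 0\<^sub>v n \<Longrightarrow> v = 0\<^sub>v n"
  shows "det M \<noteq> 0"
proof
  assume "det M = 0"
  then obtain v where "v \<in> carrier_vec n" "v \<noteq> 0\<^sub>v n" "M *\<^sub>v v = 0\<^sub>v n"
    unfolding det_0_iff_vec_prod_zero[OF assms(1)] by (elim exE conjE)
  with assms(2) show False by metis
qed

text \<open>The determinant is the characteristic polynomial of \<open>-M\<close> at 1, hence the
  product of \<open>1 - a\<close> over its roots \<open>a\<close>, and each \<open>-a\<close> is an
  eigenvalue of \<open>M\<close>. The hypothesis speaks of eigenvalues rather than of a Hermitian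
  form because it is also applied to \<open>Hi * (B - A)\<close>, which is not Hermitian in
  general.\<close>

lemma det_add_one_ge_1:
  fixes M :: "complex mat"
  assumes M: "M \<in> carrier_mat n n"
    and ev: "\<And>v e. v \<in> carrier_vec n \<Longrightarrow> v \<noteq> 0\<^sub>v n \<Longrightarrow> M *\<^sub>v v = e \<cdot>\<^sub>v v \<Longrightarrow> e \<in> \<real> \<and> 0 \<le> Re e"
  shows "\<exists>r\<ge>1. det (1\<^sub>m n + M) = complex_of_real r"
proof -
  have mM: "- M \<in> carrier_mat n n" using M by auto
  obtain as where as: "char_poly (-M) = (\<Prod>a\<leftarrow>as. [:- a, 1:])"
    using char_poly_factorized[OF mM] by blast
  have "det (1\<^sub>m n + M) = poly (char_poly (-M)) 1"
    unfolding char_poly_matrix[OF mM]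
    by (rule arg_cong[of _ _ det], rule eq_matI) (use M in \<open>auto simp: char_matrix_def\<close>)
  also have "\<dots> = (\<Prod>a\<leftarrow>as. 1 - a)"
    unfolding as by (induction as) (auto simp: algebra_simps)
  finally have *: "det (1\<^sub>m n + M) = (\<Prod>a\<leftarrow>as. 1 - a)" .
  have "- a \<in> \<real> \<and> 0 \<le> Re (- a)" if "a \<in> set as" for a
  proof -
    have "poly (char_poly (-M)) a = 0"
      unfolding as using that by (induction as) auto
    hence "eigenvalue (-M) a" using eigenvalue_root_char_poly[OF mM] by blast
    then obtain v where v: "v \<in> carrier_vec n" "v \<noteq> 0\<^sub>v n" "- M *\<^sub>v v = a \<cdot>\<^sub>v v"
      using M unfolding eigenvalue_def eigenvector_def by auto
    have "M *\<^sub>v v = - (- M *\<^sub>v v)"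
      using M v(1) by (intro eq_vecI) auto
    also have "\<dots> = (- a) \<cdot>\<^sub>v v" unfolding v(3) using v(1) by (intro eq_vecI) auto
    finally show ?thesis using ev[OF v(1,2)] by blast
  qed
  hence "\<exists>r\<ge>1. (\<Prod>a\<leftarrow>as. 1 - a) = complex_of_real r"
  proof (induction as)
    case Nil
    show ?case by (intro exI[of _ 1]) simp
  next
    case (Cons a as)
    then obtain r where r: "r \<ge> 1" "(\<Prod>a\<leftarrow>as. 1 - a) = complex_of_real r" by auto
    have a: "1 - a = complex_of_real (1 - Re a)" "1 - Re a \<ge> 1"
      using Cons.prems[of a] by (auto simp: complex_eq_iff complex_is_Real_iff)
    have "1 * 1 \<le> (1 - Re a) * r" using r a by (intro mult_mono) auto
    thus ?case using r a by (intro exI[of _ "(1 - Re a) * r"]) auto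
  qed
  thus ?thesis by (simp add: *)
qed

text \<open>The determinant behind \<open>logdet_id_plus\<close>: all estimates are multiplicative,
  and logarithms enter only at the very end.\<close>

definition det1 :: "complex mat \<Rightarrow> real" where
  "det1 M = Re (det (1\<^sub>m (dim_row M) + M))"

lemma logdet_id_plus_eq: "logdet_id_plus M = ln (det1 M)"
  by (simp add: logdet_id_plus_def det1_def)

lemma det1_mult_commute:
  "M \<in> carrier_mat a b \<Longrightarrow> N \<in> carrier_mat b a \<Longrightarrow> det1 (M * N) = det1 (N * M)"
  using det_one_plus_mult_commute[of M a b N] by (auto simp: det1_def)

lemma psd_matD:
  assumes "psd_mat A" "A \<in> carrier_mat n n"
  shows "mat_adjoint A = A" "v \<in> carrier_vec n \<Longrightarrow> 0 \<le> Re ((A *\<^sub>v v) \<bullet>c v)"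
    "v \<in> carrier_vec n \<Longrightarrow> (A *\<^sub>v v) \<bullet>c v = complex_of_real (Re ((A *\<^sub>v v) \<bullet>c v))"
proof -
  show adj: "mat_adjoint A = A" using assms by (simp add: psd_mat_def hermitian_mat_def)
  show "0 \<le> Re ((A *\<^sub>v v) \<bullet>c v)" if "v \<in> carrier_vec n"
    using assms that by (auto simp: psd_mat_def)
  show "(A *\<^sub>v v) \<bullet>c v = complex_of_real (Re ((A *\<^sub>v v) \<bullet>c v))" if "v \<in> carrier_vec n"
    using hermitian_form_real[OF assms(2) adj that] .
qed

text \<open>An eigenvalue of \<open>A\<close> is the Rayleigh quotient of its eigenvector, hence
  real and nonnegative.\<close>

lemma det_one_plus_psd:
  assumes "A \<in> carrier_mat n n" "psd_mat A"
  shows "det (1\<^sub>m n + A) = complex_of_real (det1 A)" "1 \<le> det1 A"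
proof -
  have "\<exists>r\<ge>1. det (1\<^sub>m n + A) = complex_of_real r"
  proof (rule det_add_one_ge_1[OF assms(1)])
    fix v e assume v: "v \<in> carrier_vec n" "v \<noteq> 0\<^sub>v n" "A *\<^sub>v v = e \<cdot>\<^sub>v v"
    define x where "x = Re ((A *\<^sub>v v) \<bullet>c v)"
    have "complex_of_real x = e * complex_of_real (nsq v)" "0 \<le> x"
      using psd_matD(2)[OF assms(2,1) v(1), folded x_def] psd_matD(3)[OF assms(2,1) v(1), folded x_def] v(1)
      unfolding v(3) by (simp_all add: cscalar_self)
    moreover have "nsq v > 0" using nsq_pos v by blast
    ultimately have "e = complex_of_real (x / nsq v)" "0 \<le> x / nsq v" by (auto simp: field_simps)
    thus "e \<in> \<real> \<and> 0 \<le> Re e" by simp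
  qed
  thus "det (1\<^sub>m n + A) = complex_of_real (det1 A)" "1 \<le> det1 A"
    using assms(1) by (auto simp: det1_def)
qed

text \<open>With H = 1 + A one has 1 + B = H (1 + H^-1 (B - A)). An eigenvalue of H^-1 (B - A) is a
  generalised Rayleigh quotient, the form of \<open>B - A\<close> over the positive form of
  \<open>H\<close>, so the second factor has determinant at least 1.\<close>

lemma det1_mono:
  assumes A: "A \<in> carrier_mat n n" "psd_mat A" and B: "B \<in> carrier_mat n n" "psd_mat B"
    and le: "\<And>v. v \<in> carrier_vec n \<Longrightarrow> Re ((A *\<^sub>v v) \<bullet>c v) \<le> Re ((B *\<^sub>v v) \<bullet>c v)"
  shows "det1 A \<le> det1 B"
proof -
  define H where "H = 1\<^sub>m n + A"
  have H: "H \<in> carrier_mat n n" using A by (simp add: H_def)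
  have detH: "det H = complex_of_real (det1 A)" "1 \<le> det1 A"
    using det_one_plus_psd[OF A] by (auto simp: H_def)
  then obtain Hi where Hi: "Hi \<in> carrier_mat n n" "H * Hi = 1\<^sub>m n" "Hi * H = 1\<^sub>m n"
    using det_invertible[OF H] by auto
  have BA: "B - A \<in> carrier_mat n n" by (rule minus_carrier_mat[OF A(1)])
  have "\<exists>r\<ge>1. det (1\<^sub>m n + Hi * (B - A)) = complex_of_real r"
  proof (rule det_add_one_ge_1)
    show "Hi * (B - A) \<in> carrier_mat n n" using Hi BA by simp
    fix v e assume v: "v \<in> carrier_vec n" "v \<noteq> 0\<^sub>v n" "Hi * (B - A) *\<^sub>v v = e \<cdot>\<^sub>v v"
    have "(B - A) *\<^sub>v v = (H * Hi) *\<^sub>v ((B - A) *\<^sub>v v)" using v BA Hi by simp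
    also have "\<dots> = H *\<^sub>v (Hi * (B - A) *\<^sub>v v)"
      using H Hi(1) BA v(1) by (simp add: assoc_mult_mat_vec[of _ n n _ n])
    also have "\<dots> = e \<cdot>\<^sub>v (H *\<^sub>v v)" unfolding v(3) using H v(1) by (simp add: mult_mat_vec)
    finally have "((B - A) *\<^sub>v v) \<bullet>c v = e * ((H *\<^sub>v v) \<bullet>c v)"
      using H v by simp
    moreover have "((B - A) *\<^sub>v v) \<bullet>c v =
        complex_of_real (Re ((B *\<^sub>v v) \<bullet>c v) - Re ((A *\<^sub>v v) \<bullet>c v))"
      unfolding form_minus[OF B(1) A(1) v(1)] of_real_diff
      by (subst psd_matD(3)[OF A(2,1) v(1)], subst psd_matD(3)[OF B(2,1) v(1)]) simp
    moreover have "(H *\<^sub>v v) \<bullet>c v = complex_of_real (nsq v + Re ((A *\<^sub>v v) \<bullet>c v))"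
      unfolding H_def form_add[OF one_carrier_mat A(1) v(1)] of_real_add
      by (subst psd_matD(3)[OF A(2,1) v(1)]) (use v in \<open>simp add: cscalar_self\<close>)
    ultimately have eq: "complex_of_real (Re ((B *\<^sub>v v) \<bullet>c v) - Re ((A *\<^sub>v v) \<bullet>c v)) =
        e * complex_of_real (nsq v + Re ((A *\<^sub>v v) \<bullet>c v))" by simp
    have pos: "nsq v + Re ((A *\<^sub>v v) \<bullet>c v) > 0"
      using nsq_pos[OF v(1,2)] psd_matD(2)[OF A(2,1) v(1)] by linarith
    define r where "r = (Re ((B *\<^sub>v v) \<bullet>c v) - Re ((A *\<^sub>v v) \<bullet>c v)) / (nsq v + Re ((A *\<^sub>v v) \<bullet>c v))"
    have "e = complex_of_real r"
      unfolding r_def of_real_divide eq using pos by (simp del: of_real_add)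
    moreover have "0 \<le> r" unfolding r_def using pos le[OF v(1)] by simp
    ultimately show "e \<in> \<real> \<and> 0 \<le> Re e" by simp
  qed
  then obtain r where r: "r \<ge> 1" "det (1\<^sub>m n + Hi * (B - A)) = complex_of_real r" by blast
  have "H * (1\<^sub>m n + Hi * (B - A)) = H * 1\<^sub>m n + H * (Hi * (B - A))"
    using H Hi BA by (intro mult_add_distrib_mat) auto
  also have "H * (Hi * (B - A)) = B - A"
    using H Hi left_mult_one_mat[OF BA] BA by (simp add: assoc_mult_mat[of H n n Hi n _ n, symmetric])
  also have "H * 1\<^sub>m n + (B - A) = 1\<^sub>m n + B"
    unfolding H_def using A B by (intro eq_matI) auto
  finally have "det (1\<^sub>m n + B) = complex_of_real (det1 A * r)"
    using det_mult[OF H, of "1\<^sub>m n + Hi * (B - A)"] Hi BA detH r by simp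
  hence "det1 B = det1 A * r" using B by (simp add: det1_def)
  moreover have "det1 A * 1 \<le> det1 A * r" using detH r by (intro mult_left_mono) auto
  ultimately show ?thesis by simp
qed

lemma psd_add:
  assumes "A \<in> carrier_mat n n" "psd_mat A" "B \<in> carrier_mat n n" "psd_mat B"
  shows "psd_mat (A + B)"
  unfolding psd_mat_def hermitian_mat_def
proof (intro conjI ballI)
  show "square_mat (A + B)" using assms by auto
  show "mat_adjoint (A + B) = A + B"
    using mat_adjoint_add[OF assms(1,3)] psd_matD(1) assms by metis
  fix v :: "complex vec" assume "v \<in> carrier_vec (dim_row (A + B))"
  hence v: "v \<in> carrier_vec n" using assms by auto
  show "0 \<le> Re (((A + B) *\<^sub>v v) \<bullet>c v)"
    unfolding form_add[OF assms(1,3) v]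
    using psd_matD(2)[OF assms(2,1) v] psd_matD(2)[OF assms(4,3) v] by simp
qed

text \<open>Factoring out \<open>1 + A\<close> leaves \<open>det (1 + M\<^sup>* (1 + A)\<^sup>-\<^sup>1 M)\<close>, and \<open>(1 + A)\<^sup>-\<^sup>1 \<le> 1\<close>.\<close>

lemma det1_add_le:
  assumes A: "A \<in> carrier_mat n n" "psd_mat A" and M: "M \<in> carrier_mat n m"
  shows "det1 (A + M * mat_adjoint M) \<le> det1 A * det1 (M * mat_adjoint M)"
proof -
  define H where "H = 1\<^sub>m n + A"
  have H: "H \<in> carrier_mat n n" using A by (simp add: H_def)
  have detH: "det H = complex_of_real (det1 A)" "1 \<le> det1 A"
    using det_one_plus_psd[OF A] by (auto simp: H_def)
  then obtain Hi where Hi: "Hi \<in> carrier_mat n n" "H * Hi = 1\<^sub>m n" "Hi * H = 1\<^sub>m n"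
    using det_invertible[OF H] by auto
  have aH: "mat_adjoint H = H"
    using A psd_matD(1)[OF A(2,1)] by (simp add: H_def mat_adjoint_add[of _ n n])
  have HiH: "mat_adjoint Hi * H = 1\<^sub>m n"
    using mat_adjoint_mult[OF H Hi(1)] Hi aH by simp
  have aHi: "mat_adjoint Hi = Hi"
  proof -
    have "mat_adjoint Hi = mat_adjoint Hi * (H * Hi)" using Hi by simp
    also have "\<dots> = mat_adjoint Hi * H * Hi" using H Hi(1) by (simp add: assoc_mult_mat[of _ n n _ n _ n])
    finally show ?thesis using HiH Hi by simp
  qed
  \<comment> \<open>For \<open>y = Hi x\<close> one has \<open>x = y + A y\<close>. The form of
    \<open>Hi\<close> at \<open>x\<close> is then |y|^2 + (A y, y), and |x|^2 exceeds it by (A y, y)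
    + |A y|^2; hence \<open>Hi\<close> lies between 0 and 1 as a form.\<close>
  have form: "0 \<le> Re ((Hi *\<^sub>v x) \<bullet>c x)" "Re ((Hi *\<^sub>v x) \<bullet>c x) \<le> nsq x" if x: "x \<in> carrier_vec n" for x
  proof -
    define y where "y = Hi *\<^sub>v x"
    have y: "y \<in> carrier_vec n" using Hi x by (simp add: y_def)
    have xy: "x = H *\<^sub>v y" using H Hi x by (simp add: y_def assoc_mult_mat_vec[of H n n Hi n, symmetric])
    have Hy: "H *\<^sub>v y = y + A *\<^sub>v y" unfolding H_def using add_mult_distrib_mat_vec[OF one_carrier_mat A(1) y] y by simp
    have Ay: "A *\<^sub>v y \<in> carrier_vec n" using A y by simp
    have yA: "y \<bullet>c (A *\<^sub>v y) = (A *\<^sub>v y) \<bullet>c y"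
      using cscalar_adjoint[OF A(1) y y] psd_matD(1)[OF A(2,1)] by simp
    have cj: "conjugate (y + A *\<^sub>v y) = conjugate y + conjugate (A *\<^sub>v y)"
      using y Ay by (rule conjugate_add_vec)
    have 1: "y \<bullet>c x = y \<bullet>c y + (A *\<^sub>v y) \<bullet>c y"
      unfolding xy Hy cj using y Ay yA by (simp add: scalar_prod_add_distrib[of _ n])
    have 2: "x \<bullet>c x = y \<bullet>c y + (A *\<^sub>v y) \<bullet>c y + ((A *\<^sub>v y) \<bullet>c y + (A *\<^sub>v y) \<bullet>c (A *\<^sub>v y))"
      unfolding xy Hy cj using y Ay yA by (simp add: scalar_prod_add_distrib[of _ n] add_scalar_prod_distrib[of _ n])
    have 3: "0 \<le> Re ((A *\<^sub>v y) \<bullet>c y)" using psd_matD(2)[OF A(2,1) y] .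
    show "0 \<le> Re ((Hi *\<^sub>v x) \<bullet>c x)" using 1 3 by (simp add: y_def[symmetric] cscalar_self)
    have "nsq x = Re (x \<bullet>c x)" by (simp add: cscalar_self)
    also have "\<dots> \<ge> Re (y \<bullet>c x)" unfolding 1 2 using 3 by (simp add: cscalar_self)
    finally show "Re ((Hi *\<^sub>v x) \<bullet>c x) \<le> nsq x" by (simp add: y_def)
  qed
  have aM: "mat_adjoint M \<in> carrier_mat m n" using M by simp
  let ?C = "mat_adjoint M * (Hi * M)"
  have C: "?C \<in> carrier_mat m m" using M Hi by (intro mult_carrier_mat[OF aM]) auto
  have MM: "mat_adjoint M * M \<in> carrier_mat m m" using M aM by auto
  have Cform: "(?C *\<^sub>v v) \<bullet>c v = (Hi *\<^sub>v (M *\<^sub>v v)) \<bullet>c (M *\<^sub>v v)" if v: "v \<in> carrier_vec m" for v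
    using cscalar_adjoint[OF aM, of "Hi *\<^sub>v (M *\<^sub>v v)" v] v M aM Hi(1)
    by (simp add: assoc_mult_mat_vec[of _ m n "Hi * M" m] assoc_mult_mat_vec[of _ n n M m])
  have psdC: "psd_mat ?C"
    unfolding psd_mat_def hermitian_mat_def
  proof (intro conjI ballI)
    show "square_mat ?C" using C by auto
    have "mat_adjoint ?C = mat_adjoint (Hi * M) * M"
      using mat_adjoint_mult[OF aM, of "Hi * M" m] Hi M by simp
    also have "\<dots> = ?C"
      using mat_adjoint_mult[OF Hi(1) M] aHi Hi(1) M aM by (simp add: assoc_mult_mat[of _ m n _ n _ m])
    finally show "mat_adjoint ?C = ?C" .
    fix v :: "complex vec" assume "v \<in> carrier_vec (dim_row ?C)"
    hence v: "v \<in> carrier_vec m" using C by auto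
    show "0 \<le> Re ((?C *\<^sub>v v) \<bullet>c v)" unfolding Cform[OF v] using form M v by simp
  qed
  \<comment> \<open>The bound of \<open>Hi\<close> by 1 is used in dimension \<open>m\<close>, where
    M^H M dominates \<open>?C\<close>; commuting the factors returns to dimension
    \<open>n\<close>.\<close>
  have "det1 ?C \<le> det1 (mat_adjoint M * mat_adjoint (mat_adjoint M))"
  proof (rule det1_mono[OF C psdC _ psd_gram(1)[OF aM]])
    show "mat_adjoint M * mat_adjoint (mat_adjoint M) \<in> carrier_mat m m" using MM by simp
    fix v :: "complex vec" assume v: "v \<in> carrier_vec m"
    show "Re ((?C *\<^sub>v v) \<bullet>c v) \<le> Re ((mat_adjoint M * mat_adjoint (mat_adjoint M) *\<^sub>v v) \<bullet>c v)"
      unfolding Cform[OF v] psd_gram(2)[OF aM v] using form M v by simp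
  qed
  hence le: "det1 ?C \<le> det1 (M * mat_adjoint M)"
    using det1_mult_commute[OF M aM] by simp
  have HiM: "Hi * M \<in> carrier_mat n m" using Hi(1) M by (rule mult_carrier_mat)
  have "1\<^sub>m n + (A + M * mat_adjoint M) = H * (1\<^sub>m n + (Hi * M) * mat_adjoint M)"
  proof -
    have "H * (1\<^sub>m n + (Hi * M) * mat_adjoint M) = H * 1\<^sub>m n + H * ((Hi * M) * mat_adjoint M)"
      using H Hi M aM by (intro mult_add_distrib_mat) auto
    also have "H * ((Hi * M) * mat_adjoint M) = (H * Hi) * M * mat_adjoint M"
      using H Hi(1) M aM by (simp add: assoc_mult_mat[of H n n "Hi * M" m _ n, symmetric] assoc_mult_mat[of H n n Hi n M m])
    also have "\<dots> = M * mat_adjoint M" using Hi M by simp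
    also have "H * 1\<^sub>m n + M * mat_adjoint M = 1\<^sub>m n + (A + M * mat_adjoint M)"
      unfolding H_def using A M by (intro eq_matI) (auto simp: algebra_simps)
    finally show ?thesis by simp
  qed
  hence "det (1\<^sub>m n + (A + M * mat_adjoint M)) = det H * det (1\<^sub>m n + (Hi * M) * mat_adjoint M)"
    using det_mult[OF H, of "1\<^sub>m n + (Hi * M) * mat_adjoint M"] add_carrier_mat[OF mult_carrier_mat[OF HiM aM]]
    by (simp only:)
  also have "det (1\<^sub>m n + (Hi * M) * mat_adjoint M) = det (1\<^sub>m m + ?C)"
    by (rule det_one_plus_mult_commute[OF HiM aM])
  also have "\<dots> = complex_of_real (det1 ?C)" using det_one_plus_psd[OF C psdC] by simp
  finally have "det1 (A + M * mat_adjoint M) = det1 A * det1 ?C"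
    using A M detH by (simp add: det1_def)
  also have "\<dots> \<le> det1 A * det1 (M * mat_adjoint M)"
    using le detH by (intro mult_left_mono) auto
  finally show ?thesis .
qed

subsection \<open>Pseudoinverse and spectral norm\<close>

text \<open>Rank \<open>k\<close> provides \<open>k\<close> independent columns of \<open>M\<close>,
  a basis of the whole space. A vector killed by the adjoint is orthogonal to every column, hence to
  itself.\<close>

lemma full_row_rank_adjoint_injective:
  fixes M :: "complex mat"
  assumes M: "M \<in> carrier_mat k l" and rank: "vec_space.rank k M = k"
    and v: "v \<in> carrier_vec k" and Mv: "mat_adjoint M *\<^sub>v v = 0\<^sub>v l"
  shows "v = 0\<^sub>v k"
proof -
  interpret vec_space "TYPE(complex)" k .
  have cols: "set (cols M) \<subseteq> carrier_vec k" using cols_dim M by blast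
  obtain S where S: "finite S" "maximal S (\<lambda>T. T \<subseteq> set (cols M) \<and> lin_indpt T)"
    using maximal_exists_superset[of "set (cols M)" "\<lambda>T. T \<subseteq> set (cols M) \<and> lin_indpt T" "{}"]
    by (auto simp: lin_dep_def)
  have S': "S \<subseteq> set (cols M)" "lin_indpt S" using S(2) by (auto simp: maximal_def)
  have "card S = k" using rank_card_indpt[OF M S(2)] rank by simp
  hence "basis S" using S S' cols dim_is_n by (intro dim_li_is_basis) auto
  hence span: "span S = carrier_vec k" by (simp add: basis_def)
  \<comment> \<open>The library's orthogonal complement refers to the bilinear product \<bullet>,
    which is why \<open>conjugate v\<close> takes the place of \<open>v\<close>.\<close>
  have "conjugate v \<bullet> y = 0" if y: "y \<in> set (cols M)" for y
  proof -
    obtain j where j: "j < l" "y = col M j" using y M by (auto simp: cols_def)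
    have "(mat_adjoint M *\<^sub>v v) $ j = 0" using j by (simp add: Mv)
    hence "cnj (\<Sum>i<k. cnj (M $$ (i,j)) * v $ i) = 0"
      using M v j by (simp add: mult_vec_index del: index_mult_mat_vec)
    moreover have "cnj (\<Sum>i<k. cnj (M $$ (i,j)) * v $ i) = conjugate v \<bullet> y"
      using M v j by (auto simp: scalar_prod_def atLeast0LessThan conjugate_complex_def mult.commute)
    ultimately show ?thesis by simp
  qed
  hence "conjugate v \<in> orthogonal_complement (span S)"
    using S' cols v by (subst in_orthogonal_complement_span) (auto simp: orthogonal_complement_def)
  hence "conjugate v \<bullet> v = 0" using v by (auto simp: span orthogonal_complement_def)
  hence "v \<bullet>c v = 0" using v by (subst comm_scalar_prod[of _ k]) auto
  thus ?thesis using v by simp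
qed

text \<open>Full row rank makes M M^H invertible, and M^H (M M^H)^-1 satisfies the four Penrose
  equations. As \<open>pinv\<close> is a definite description, uniqueness of the solution has to be
  shown as well.\<close>

lemma pinv_full_row_rank:
  fixes M :: "complex mat"
  assumes M: "M \<in> carrier_mat k l" and rank: "vec_space.rank k M = k"
  shows "pinv M \<in> carrier_mat l k" "M * pinv M = 1\<^sub>m k"
proof -
  let ?P = "\<lambda>X. X \<in> carrier_mat l k \<and> M * X * M = M \<and> X * M * X = X \<and>
      mat_adjoint (M * X) = M * X \<and> mat_adjoint (X * M) = X * M"
  have aM: "mat_adjoint M \<in> carrier_mat l k" using M by simp
  define H where "H = M * mat_adjoint M"
  have H: "H \<in> carrier_mat k k" using M aM by (simp add: H_def)
  have "det H \<noteq> 0"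
  proof (rule det_nonzero_if_injective[OF H])
    fix v assume v: "v \<in> carrier_vec k" "H *\<^sub>v v = 0\<^sub>v k"
    have "nsq (mat_adjoint M *\<^sub>v v) = 0"
      using psd_gram(2)[OF M v(1)] v by (simp add: H_def[symmetric])
    hence "mat_adjoint M *\<^sub>v v = 0\<^sub>v l" using aM v(1) nsq_eq_0[of _ l] by auto
    thus "v = 0\<^sub>v k" using full_row_rank_adjoint_injective[OF M rank v(1)] by blast
  qed
  then obtain Hi where Hi: "Hi \<in> carrier_mat k k" "H * Hi = 1\<^sub>m k" "Hi * H = 1\<^sub>m k"
    using det_invertible[OF H] by auto
  have aH: "mat_adjoint H = H" unfolding H_def using mat_adjoint_mult[OF M aM] by simp
  have aHi: "mat_adjoint Hi = Hi"
  proof -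
    have "mat_adjoint Hi * H = 1\<^sub>m k" using mat_adjoint_mult[OF H Hi(1)] Hi aH by simp
    hence "mat_adjoint Hi * H * Hi = Hi" using Hi by simp
    moreover have "mat_adjoint Hi * H * Hi = mat_adjoint Hi * (H * Hi)"
      using H Hi(1) by (intro assoc_mult_mat[of _ k k _ k _ k]) auto
    ultimately show ?thesis using Hi by simp
  qed
  define X0 where "X0 = mat_adjoint M * Hi"
  have X0: "X0 \<in> carrier_mat l k" using aM Hi by (simp add: X0_def)
  have MX0: "M * X0 = 1\<^sub>m k"
    using assoc_mult_mat[OF M aM Hi(1)] Hi(2) by (simp only: X0_def H_def)
  have X0M: "mat_adjoint (X0 * M) = X0 * M"
  proof -
    have "mat_adjoint (X0 * M) = mat_adjoint M * mat_adjoint X0" using mat_adjoint_mult[OF X0 M] .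
    also have "mat_adjoint X0 = Hi * M" unfolding X0_def using mat_adjoint_mult[OF aM Hi(1)] aHi by simp
    also have "mat_adjoint M * (Hi * M) = X0 * M" 
      unfolding X0_def by (rule assoc_mult_mat[OF aM Hi(1) M, symmetric])
    finally show ?thesis .
  qed
  have P: "?P X0"
  proof (intro conjI)
    show "X0 * M * X0 = X0" unfolding assoc_mult_mat[OF X0 M X0] MX0 using X0 by simp
  qed (use X0 MX0 X0M M in auto)
  \<comment> \<open>\<open>M Y M = M\<close> gives \<open>M X = (M Y) (M X)\<close>. Both factors
    are Hermitian, so taking adjoints swaps them, and \<open>M X M = M\<close> leaves
    \<open>M Y\<close>. Likewise \<open>X M = Y M\<close>, and these two products determine the
    inverse.\<close>
  have uniq: "X = Y" if X: "?P X" and Y: "?P Y" for X Y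
  proof -
    have c: "X \<in> carrier_mat l k" "Y \<in> carrier_mat l k" using X Y by auto
    have "M * X = M * Y"
    proof -
      have "M * X = M * Y * (M * X)"
        using Y assoc_mult_mat[of "M * Y" k k M l X k] M c by (metis mult_carrier_mat)
      hence "mat_adjoint (M * X) = mat_adjoint (M * X) * mat_adjoint (M * Y)"
        using mat_adjoint_mult[of "M * Y" k k "M * X" k] M c by (metis mult_carrier_mat)
      hence "M * X = M * X * (M * Y)" using X Y by metis
      also have "\<dots> = M * Y"
        using X assoc_mult_mat[of "M * X" k k M l Y k] M c by (metis mult_carrier_mat)
      finally show ?thesis .
    qed
    moreover have "X * M = Y * M"
    proof -
      have "X * M = X * M * (Y * M)"
        using Y assoc_mult_mat[of X l k M l "Y * M" l] assoc_mult_mat[of M k l Y k M l] M c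
        by (metis mult_carrier_mat)
      hence "mat_adjoint (X * M) = mat_adjoint (Y * M) * mat_adjoint (X * M)"
        using mat_adjoint_mult[of "X * M" l l "Y * M" l] M c by (metis mult_carrier_mat)
      hence "X * M = Y * M * (X * M)" using X Y by metis
      also have "\<dots> = Y * M"
        using X assoc_mult_mat[of Y l k M l "X * M" l] assoc_mult_mat[of M k l X k M l] M c
        by (metis mult_carrier_mat)
      finally show ?thesis .
    qed
    moreover have "X * M * X = X" "Y * M * Y = Y" using X Y by auto
    moreover have "X * M * X = X * (M * X)" "Y * M * Y = Y * (M * Y)" "Y * M * X = Y * (M * X)"
      using M c by auto
    ultimately show "X = Y" by metis
  qed
  have "pinv M = (THE X. ?P X)" unfolding pinv_def using M by simp
  also have "\<dots> = X0" by (rule the_equality[where P = ?P, OF P]) (rule uniq[OF _ P])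
  finally show "pinv M \<in> carrier_mat l k" "M * pinv M = 1\<^sub>m k" using X0 MX0 by auto
qed

lemma nsq_smult: "nsq (c \<cdot>\<^sub>v v) = (cmod c)\<^sup>2 * nsq v"
  by (simp add: nsq_def norm_mult power_mult_distrib sum_distrib_left)

lemma spec_norm_bound:
  fixes M :: "complex mat"
  assumes M: "M \<in> carrier_mat a b" and v: "v \<in> carrier_vec b"
  shows "sqrt (nsq (M *\<^sub>v v)) \<le> spec_norm M * sqrt (nsq v)"
proof (cases "v = 0\<^sub>v b")
  case True
  have "nsq (M *\<^sub>v v) = 0" using M True by (auto simp: nsq_def scalar_prod_def)
  moreover have "nsq v = 0" using True by (simp add: nsq_def)
  ultimately show ?thesis by simp
next
  case False
  hence pos: "0 < nsq v" using nsq_pos[OF v] by simp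
  let ?S = "{vnorm2 (M *\<^sub>v w) | w. w \<in> carrier_vec (dim_col M) \<and> vnorm2 w = 1}"
  \<comment> \<open>The supremum is an upper bound only for a bounded set: entries of a unit vector
    have modulus at most 1, so row sums of moduli bound the entries of the image.\<close>
  have bdd: "bdd_above ?S"
  proof (rule bdd_aboveI)
    fix x assume "x \<in> ?S"
    then obtain w where w: "w \<in> carrier_vec b" "nsq w = 1" "x = sqrt (nsq (M *\<^sub>v w))"
      using M by (auto simp: vnorm2_eq)
    have wj: "cmod (w $ j) \<le> 1" if "j < b" for j
    proof -
      have "(cmod (w $ j))\<^sup>2 \<le> nsq w"
        unfolding nsq_def using w that by (intro member_le_sum) auto
      thus ?thesis using w by (simp add: power_le_one_iff abs_square_le_1)
    qed
    have "cmod ((M *\<^sub>v w) $ i) \<le> (\<Sum>j<b. cmod (M $$ (i,j)))" if "i < a" for i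
    proof -
      have "cmod ((M *\<^sub>v w) $ i) \<le> (\<Sum>j<b. cmod (M $$ (i,j)) * cmod (w $ j))"
        using M w that by (auto simp: mult_vec_index norm_mult[symmetric] norm_sum simp del: index_mult_mat_vec)
      also have "\<dots> \<le> (\<Sum>j<b. cmod (M $$ (i,j)) * 1)"
        using wj by (intro sum_mono mult_left_mono) auto
      finally show ?thesis by simp
    qed
    hence "nsq (M *\<^sub>v w) \<le> (\<Sum>i<a. (\<Sum>j<b. cmod (M $$ (i,j)))\<^sup>2)"
      unfolding nsq_def using M by (auto intro!: sum_mono power_mono simp del: index_mult_mat_vec)
    thus "x \<le> sqrt (\<Sum>i<a. (\<Sum>j<b. cmod (M $$ (i,j)))\<^sup>2)" using w by simp
  qed
  define c where "c = complex_of_real (1 / sqrt (nsq v))"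
  have c: "(cmod c)\<^sup>2 = 1 / nsq v" using pos by (simp add: c_def norm_divide power_divide)
  have "vnorm2 (M *\<^sub>v (c \<cdot>\<^sub>v v)) \<in> ?S"
    using M v c pos by (auto simp: vnorm2_eq nsq_smult intro!: exI[of _ "c \<cdot>\<^sub>v v"])
  hence "vnorm2 (M *\<^sub>v (c \<cdot>\<^sub>v v)) \<le> spec_norm M"
    unfolding spec_norm_def using bdd by (rule cSup_upper)
  hence "sqrt (nsq (M *\<^sub>v v) / nsq v) \<le> spec_norm M"
    using M v c by (simp add: vnorm2_eq mult_mat_vec nsq_smult)
  thus ?thesis using pos by (simp add: real_sqrt_divide divide_le_eq)
qed

text \<open>For y = M^H w, Cauchy-Schwarz gives |y|^2 = (M y, w) \<le> \<open>spec_norm M\<close>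
  |y| |w|, and one factor |y| cancels.\<close>

lemma spec_norm_adjoint_bound:
  fixes M :: "complex mat"
  assumes M: "M \<in> carrier_mat a b" and w: "w \<in> carrier_vec a"
  shows "nsq (mat_adjoint M *\<^sub>v w) \<le> (spec_norm M)\<^sup>2 * nsq w"
proof (cases "nsq (mat_adjoint M *\<^sub>v w) = 0")
  case True
  thus ?thesis by simp
next
  case False
  define y where "y = mat_adjoint M *\<^sub>v w"
  have y: "y \<in> carrier_vec b"
    unfolding y_def by (rule mult_mat_vec_carrier[OF mat_adjoint_carrier[OF M] w])
  hence ypos: "sqrt (nsq y) > 0" using False nsq_nonneg[of y] by (simp add: y_def less_le del: nsq_nonneg)
  have My: "M *\<^sub>v y \<in> carrier_vec a" using M y by simp
  have "complex_of_real (nsq y) = (M *\<^sub>v y) \<bullet>c w"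
    using cscalar_adjoint[OF M y w] by (simp add: y_def[symmetric] cscalar_self)
  hence "nsq y = cmod ((M *\<^sub>v y) \<bullet>c w)" by (metis abs_of_nonneg norm_of_real nsq_nonneg)
  also have "\<dots> \<le> sqrt (nsq (M *\<^sub>v y)) * sqrt (nsq w)"
    by (rule cscalar_cauchy_schwarz[OF My w])
  also have "\<dots> \<le> spec_norm M * sqrt (nsq y) * sqrt (nsq w)"
    by (intro mult_right_mono spec_norm_bound[OF M y]) simp
  finally have "sqrt (nsq y) * sqrt (nsq y) \<le> sqrt (nsq y) * (spec_norm M * sqrt (nsq w))"
    by (simp add: ac_simps)
  hence "sqrt (nsq y) \<le> spec_norm M * sqrt (nsq w)" using ypos by (rule mult_left_le_imp_le)
  hence "(sqrt (nsq y))\<^sup>2 \<le> (spec_norm M * sqrt (nsq w))\<^sup>2" using ypos by (intro power_mono) auto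
  thus ?thesis by (simp add: y_def power_mult_distrib)
qed

subsection \<open>Chebyshev polynomials\<close>

text \<open>The identity cos (s + t) + cos (s - t) = 2 cos s cos t with s = (m + 1) t is the
  Chebyshev recurrence.\<close>

lemma cheb_cos: "cheb m (cos t) = cos (real m * t)"
proof (induction m "cos t" rule: cheb.induct)
  case (3 m)
  have *: "real (Suc (Suc m)) * t = real (Suc m) * t + t" "real m * t = real (Suc m) * t - t"
    by (simp_all add: algebra_simps)
  show ?case by (simp only: cheb.simps 3 * cos_add cos_diff) (simp add: algebra_simps)
qed auto

lemma abs_cheb_le_1: "\<bar>x\<bar> \<le> 1 \<Longrightarrow> \<bar>cheb m x\<bar> \<le> 1"
  using cheb_cos[of m "arccos x"] by (simp add: cos_arccos_abs)

lemma cheb_mono: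
  assumes "1 \<le> x" "x \<le> y"
  shows "1 \<le> cheb m x" "cheb m x \<le> cheb m y"
proof -
  \<comment> \<open>The increments in the degree join the induction: T_{m+2} - T_{m+1} = (T_{m+1} -
    T_m) + 2 (x - 1) T_{m+1}, where on [1, \<infinity>) both terms on the right are nonnegative and
    nondecreasing in \<open>x\<close>.\<close>
  have "1 \<le> cheb m x \<and> cheb m x \<le> cheb m y \<and> 0 \<le> cheb (Suc m) x - cheb m x \<and>
      cheb (Suc m) x - cheb m x \<le> cheb (Suc m) y - cheb m y"
  proof (induction m)
    case 0
    show ?case using assms by simp
  next
    case (Suc m)
    have 1: "cheb (Suc (Suc m)) z - cheb (Suc m) z =
        (cheb (Suc m) z - cheb m z) + 2 * ((z - 1) * cheb (Suc m) z)" for z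
      by (simp add: algebra_simps)
    have "0 \<le> (x - 1) * cheb (Suc m) x" using assms Suc by (intro mult_nonneg_nonneg) linarith+
    moreover have "(x - 1) * cheb (Suc m) x \<le> (y - 1) * cheb (Suc m) y"
      using assms Suc by (intro mult_mono) linarith+
    ultimately show ?case unfolding 1 using Suc by linarith
  qed
  thus "1 \<le> cheb m x" "cheb m x \<le> cheb m y" by auto
qed

text \<open>The moment functional vanishes on t, ..., t^q, hence on t^a times any polynomial of
  degree \<open>m\<close> when \<open>a + m\<close> is at most \<open>q\<close>. The induction
  follows the Chebyshev recurrence instead of expanding in powers; \<open>a\<close> varies because
  that recurrence multiplies by t.\<close>

lemma moments_zero_cheb:
  fixes c :: "nat \<Rightarrow> complex" and lam :: "nat \<Rightarrow> real"
  assumes mom: "\<And>j. 1 \<le> j \<Longrightarrow> j \<le> q \<Longrightarrow> (\<Sum>i<n. c i * complex_of_real (lam i ^ j)) = 0"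
    and mu: "mu \<noteq> 0" and a: "1 \<le> a" "a + m \<le> q"
  shows "(\<Sum>i<n. c i * complex_of_real (lam i ^ a * cheb m ((2 * lam i - mu) / mu))) = 0"
  using a
proof (induction m arbitrary: a rule: induct_nat_012)
  case 0
  thus ?case using mom[of a] by simp
next
  case 1
  have "(\<Sum>i<n. c i * complex_of_real (lam i ^ a * cheb 1 ((2 * lam i - mu) / mu))) =
      complex_of_real (2 / mu) * (\<Sum>i<n. c i * complex_of_real (lam i ^ (a + 1))) -
      (\<Sum>i<n. c i * complex_of_real (lam i ^ a))"
    unfolding sum_distrib_left sum_subtractf[symmetric]
    using mu by (intro sum.cong) (auto simp: field_simps)
  thus ?case using mom[of a] mom[of "a+1"] 1 by simp
next
  case (ge2 m)
  have "(\<Sum>i<n. c i * complex_of_real (lam i ^ a * cheb (Suc (Suc m)) ((2 * lam i - mu) / mu))) =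
      complex_of_real (4 / mu) *
        (\<Sum>i<n. c i * complex_of_real (lam i ^ (a + 1) * cheb (Suc m) ((2 * lam i - mu) / mu))) -
      2 * (\<Sum>i<n. c i * complex_of_real (lam i ^ a * cheb (Suc m) ((2 * lam i - mu) / mu))) -
      (\<Sum>i<n. c i * complex_of_real (lam i ^ a * cheb m ((2 * lam i - mu) / mu)))"
    unfolding sum_distrib_left sum_subtractf[symmetric]
  proof (intro sum.cong refl)
    fix i
    \<comment> \<open>In the recurrence, twice the shifted argument (2 t - mu) / mu is 4 t / mu -
      2.\<close>
    have "lam i ^ a * cheb (Suc (Suc m)) ((2 * lam i - mu) / mu) =
        4 / mu * (lam i ^ (a + 1) * cheb (Suc m) ((2 * lam i - mu) / mu)) -
        2 * (lam i ^ a * cheb (Suc m) ((2 * lam i - mu) / mu)) -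
        lam i ^ a * cheb m ((2 * lam i - mu) / mu)"
      using mu by (simp add: field_simps)
    thus "c i * complex_of_real (lam i ^ a * cheb (Suc (Suc m)) ((2 * lam i - mu) / mu)) =
      complex_of_real (4 / mu) * (c i * complex_of_real (lam i ^ (a + 1) * cheb (Suc m) ((2 * lam i - mu) / mu))) -
      2 * (c i * complex_of_real (lam i ^ a * cheb (Suc m) ((2 * lam i - mu) / mu))) -
      c i * complex_of_real (lam i ^ a * cheb m ((2 * lam i - mu) / mu))"
      by (simp only: of_real_diff of_real_mult of_real_numeral) (simp only: algebra_simps)
  qed
  also have "\<dots> = 0"
    using ge2.IH(1)[of a] ge2.IH(2)[of a] ge2.IH(2)[of "a + 1"] ge2.prems by (simp only:) simp
  finally show ?case .
qed

subsection \<open>Compressions\<close>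

text \<open>With \<open>w = (1 - Q Q\<^sup>*) x = Y y\<close> one has \<open>|w|\<^sup>2 = x\<^sup>* w = (Y\<^sup>* x)\<^sup>* y \<le> |Y\<^sup>* x| |w|\<close>.\<close>

lemma complement_projection_le:
  fixes Q Y :: "complex mat"
  assumes Q: "Q \<in> carrier_mat n m" and orth: "mat_adjoint Q * Q = 1\<^sub>m m"
    and Y: "Y \<in> carrier_mat n r"
    and cover: "\<And>w. w \<in> carrier_vec n \<Longrightarrow> mat_adjoint Q *\<^sub>v w = 0\<^sub>v m \<Longrightarrow>
      \<exists>y \<in> carrier_vec r. w = Y *\<^sub>v y \<and> nsq y \<le> nsq w"
    and x: "x \<in> carrier_vec n"
  shows "nsq ((1\<^sub>m n - Q * mat_adjoint Q) *\<^sub>v x) \<le> nsq (mat_adjoint Y *\<^sub>v x)"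
proof -
  have aQ: "mat_adjoint Q \<in> carrier_mat m n" and aY: "mat_adjoint Y \<in> carrier_mat r n"
    using Q Y by auto
  have QQ: "Q * mat_adjoint Q \<in> carrier_mat n n" using Q aQ by (rule mult_carrier_mat)
  define w where "w = (1\<^sub>m n - Q * mat_adjoint Q) *\<^sub>v x"
  define a where "a = mat_adjoint Q *\<^sub>v x"
  have a: "a \<in> carrier_vec m" unfolding a_def by (rule mult_mat_vec_carrier[OF aQ x])
  have Qa: "Q *\<^sub>v a \<in> carrier_vec n" using Q a by (rule mult_mat_vec_carrier)
  have w_eq: "w = x - Q *\<^sub>v a"
    unfolding w_def a_def minus_mult_distrib_mat_vec[OF one_carrier_mat QQ x]
      assoc_mult_mat_vec[OF Q aQ x] using x by simp
  have w: "w \<in> carrier_vec n" unfolding w_eq using x Qa by simp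
  have Qw: "mat_adjoint Q *\<^sub>v w = 0\<^sub>v m"
  proof -
    have "mat_adjoint Q *\<^sub>v w = a - mat_adjoint Q *\<^sub>v (Q *\<^sub>v a)"
      unfolding w_eq mult_minus_distrib_mat_vec[OF aQ x Qa] unfolding a_def ..
    also have "mat_adjoint Q *\<^sub>v (Q *\<^sub>v a) = a"
      using assoc_mult_mat_vec[OF aQ Q a] orth a by simp
    finally show ?thesis using a by simp
  qed
  obtain y where y: "y \<in> carrier_vec r" "w = Y *\<^sub>v y" "nsq y \<le> nsq w"
    using cover[OF w Qw] by blast
  have "(Q *\<^sub>v a) \<bullet>c w = 0"
    unfolding cscalar_adjoint[OF Q a w] Qw using a by (simp add: cscalar_sum[of _ m])
  hence "w \<bullet>c w = x \<bullet>c w"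
    using x Qa w minus_scalar_prod_distrib[of x n "Q *\<^sub>v a" "conjugate w"] unfolding w_eq by simp
  also have "\<dots> = (mat_adjoint Y *\<^sub>v x) \<bullet>c y"
    using cscalar_adjoint[OF aY x y(1)] y(2) by simp
  finally have "complex_of_real (nsq w) = (mat_adjoint Y *\<^sub>v x) \<bullet>c y"
    by (simp add: cscalar_self)
  hence "nsq w = cmod ((mat_adjoint Y *\<^sub>v x) \<bullet>c y)" by (metis abs_of_nonneg norm_of_real nsq_nonneg)
  also have "\<dots> \<le> sqrt (nsq (mat_adjoint Y *\<^sub>v x)) * sqrt (nsq y)"
    by (rule cscalar_cauchy_schwarz[OF mult_mat_vec_carrier[OF aY x] y(1)])
  also have "\<dots> \<le> sqrt (nsq (mat_adjoint Y *\<^sub>v x)) * sqrt (nsq w)"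
    using y by (intro mult_left_mono) auto
  finally have *: "sqrt (nsq w) * sqrt (nsq w) \<le> sqrt (nsq (mat_adjoint Y *\<^sub>v x)) * sqrt (nsq w)" by simp
  have "nsq w \<le> nsq (mat_adjoint Y *\<^sub>v x)"
  proof (cases "nsq w = 0")
    case False
    hence "0 < sqrt (nsq w)" using nsq_nonneg[of w] by (simp add: less_le del: nsq_nonneg)
    with * have "sqrt (nsq w) \<le> sqrt (nsq (mat_adjoint Y *\<^sub>v x))" by (rule mult_right_le_imp_le)
    thus ?thesis by simp
  qed simp
  thus ?thesis by (simp add: w_def)
qed

text \<open>S^H S is the sum of the Gram matrices S^H Q Q^H S and S^H (1 - Q Q^H) S, the first of
  which has the same \<open>det1\<close> as Q^H A Q. Monotonicity gives the comparison with
  \<open>A\<close>; \<open>det1_add_le\<close> gives the product bound, after which 1 - Q Q^H is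
  replaced by Y Y^H.\<close>

lemma det1_compression:
  fixes Q S :: "complex mat"
  assumes S: "S \<in> carrier_mat n n" and Q: "Q \<in> carrier_mat n m" and orth: "mat_adjoint Q * Q = 1\<^sub>m m"
  defines "A \<equiv> S * mat_adjoint S"
  shows "1 \<le> det1 (mat_adjoint Q * A * Q)" "det1 (mat_adjoint Q * A * Q) \<le> det1 A"
    "\<lbrakk>Y \<in> carrier_mat n r; \<And>w. w \<in> carrier_vec n \<Longrightarrow> mat_adjoint Q *\<^sub>v w = 0\<^sub>v m \<Longrightarrow>
      \<exists>y \<in> carrier_vec r. w = Y *\<^sub>v y \<and> nsq y \<le> nsq w\<rbrakk> \<Longrightarrow>
      det1 A \<le> det1 (mat_adjoint Q * A * Q) * det1 (mat_adjoint Y * A * Y)"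
proof -
  have aS: "mat_adjoint S \<in> carrier_mat n n" and aQ: "mat_adjoint Q \<in> carrier_mat m n"
    using S Q by auto
  have A: "A \<in> carrier_mat n n" unfolding A_def using S aS by (rule mult_carrier_mat)
  \<comment> \<open>Since A = S S^H, every compression M^H A M is a Gram matrix; commuting its
    factors moves all determinants to size \<open>n\<close>, where they can be compared.\<close>
  have gram_eq: "mat_adjoint M * A * M = mat_adjoint (mat_adjoint S * M) * (mat_adjoint S * M)"
    "det1 ((mat_adjoint S * M) * mat_adjoint (mat_adjoint S * M)) = det1 (mat_adjoint M * A * M)"
    if M: "M \<in> carrier_mat n j" for M j
  proof -
    have SM: "mat_adjoint S * M \<in> carrier_mat n j" using aS M by (rule mult_carrier_mat)
    have aM: "mat_adjoint M \<in> carrier_mat j n" using M by simp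
    show *: "mat_adjoint M * A * M = mat_adjoint (mat_adjoint S * M) * (mat_adjoint S * M)"
      unfolding mat_adjoint_mult[OF aS M] A_def
      using S aS M aM SM assoc_mult_mat[of "mat_adjoint M" j n S n "mat_adjoint S * M" j]
        assoc_mult_mat[of "mat_adjoint M" j n "S * mat_adjoint S" n M j]
        assoc_mult_mat[of S n n "mat_adjoint S" n M j] by simp
    show "det1 ((mat_adjoint S * M) * mat_adjoint (mat_adjoint S * M)) = det1 (mat_adjoint M * A * M)"
      unfolding * by (rule det1_mult_commute[OF SM mat_adjoint_carrier[OF SM]])
  qed
  define P where "P = 1\<^sub>m n - Q * mat_adjoint Q"
  have QQ: "Q * mat_adjoint Q \<in> carrier_mat n n" using Q aQ by (rule mult_carrier_mat)
  have P: "P \<in> carrier_mat n n" unfolding P_def by (rule minus_carrier_mat[OF QQ])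
  have aP: "mat_adjoint P = P"
    unfolding P_def mat_adjoint_minus[OF one_carrier_mat QQ] mat_adjoint_mult[OF Q aQ] by simp
  \<comment> \<open>Idempotence of the Hermitian matrix \<open>P\<close> turns S^H P S into the Gram
    matrix of S^H P.\<close>
  have PP: "P * P = P"
  proof -
    have "Q * mat_adjoint Q * (Q * mat_adjoint Q) = Q * (mat_adjoint Q * Q * mat_adjoint Q)"
      using Q aQ QQ assoc_mult_mat[OF Q aQ QQ] assoc_mult_mat[OF aQ Q aQ] by simp
    hence QQ2: "Q * mat_adjoint Q * (Q * mat_adjoint Q) = Q * mat_adjoint Q"
      using orth left_mult_one_mat[OF aQ] by simp
    have "P * P = 1\<^sub>m n * P - Q * mat_adjoint Q * P"
      unfolding P_def by (rule minus_mult_distrib_mat[OF one_carrier_mat QQ]) (use P in \<open>simp add: P_def\<close>)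
    also have "Q * mat_adjoint Q * P = Q * mat_adjoint Q * 1\<^sub>m n - Q * mat_adjoint Q * (Q * mat_adjoint Q)"
      unfolding P_def by (rule mult_minus_distrib_mat[OF QQ one_carrier_mat QQ])
    also have "\<dots> = 0\<^sub>m n n" unfolding QQ2 right_mult_one_mat[OF QQ] by (rule minus_r_inv_mat[OF QQ])
    finally have "P * P = P - 0\<^sub>m n n" using P by simp
    also have "\<dots> = P" using P by (intro eq_matI) auto
    finally show ?thesis .
  qed
  let ?B = "(mat_adjoint S * Q) * mat_adjoint (mat_adjoint S * Q)"
  let ?N = "mat_adjoint S * P"
  have SQ: "mat_adjoint S * Q \<in> carrier_mat n m" using aS Q by (rule mult_carrier_mat)
  have B: "?B \<in> carrier_mat n n" "psd_mat ?B"
    using psd_gram(1)[OF SQ] mult_carrier_mat[OF SQ mat_adjoint_carrier[OF SQ]] by auto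
  have N: "?N \<in> carrier_mat n n" using aS P by (rule mult_carrier_mat)
  have NN: "?N * mat_adjoint ?N \<in> carrier_mat n n" "psd_mat (?N * mat_adjoint ?N)"
    using psd_gram(1)[OF N] mult_carrier_mat[OF N mat_adjoint_carrier[OF N]] by auto
  have B_eq: "?B = mat_adjoint S * (Q * mat_adjoint Q) * S"
    unfolding mat_adjoint_mult[OF aS Q] using S aS Q aQ QQ
      assoc_mult_mat[OF aS Q mult_carrier_mat[OF aQ S]] assoc_mult_mat[OF Q aQ S] assoc_mult_mat[OF aS QQ S]
    by simp
  have N_eq: "?N * mat_adjoint ?N = mat_adjoint S * P * S"
    unfolding mat_adjoint_mult[OF aS P] aP using S aS P PP
      assoc_mult_mat[OF aS P mult_carrier_mat[OF P S]] assoc_mult_mat[OF P P S] assoc_mult_mat[OF aS P S]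
    by simp
  have "?B + ?N * mat_adjoint ?N = (mat_adjoint S * (Q * mat_adjoint Q) + mat_adjoint S * P) * S"
    unfolding B_eq N_eq by (rule add_mult_distrib_mat[OF mult_carrier_mat[OF aS QQ] N S, symmetric])
  also have "mat_adjoint S * (Q * mat_adjoint Q) + mat_adjoint S * P = mat_adjoint S * (Q * mat_adjoint Q + P)"
    by (rule mult_add_distrib_mat[OF aS QQ P, symmetric])
  also have "Q * mat_adjoint Q + P = 1\<^sub>m n" unfolding P_def using QQ Q by (intro eq_matI) auto
  finally have sum: "?B + ?N * mat_adjoint ?N = mat_adjoint S * S" unfolding right_mult_one_mat[OF aS] .
  have detA: "det1 A = det1 (?B + ?N * mat_adjoint ?N)"
    unfolding sum A_def by (rule det1_mult_commute[OF S aS])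
  have detT: "det1 ?B = det1 (mat_adjoint Q * A * Q)" by (rule gram_eq(2)[OF Q])
  show T1: "1 \<le> det1 (mat_adjoint Q * A * Q)"
    unfolding detT[symmetric] using det_one_plus_psd(2)[OF B] .
  show "det1 (mat_adjoint Q * A * Q) \<le> det1 A"
    unfolding detT[symmetric] detA
  proof (rule det1_mono[OF B _ psd_add[OF B NN]])
    show "?B + ?N * mat_adjoint ?N \<in> carrier_mat n n" using NN(1) by (rule add_carrier_mat)
    fix v :: "complex vec" assume v: "v \<in> carrier_vec n"
    show "Re ((?B *\<^sub>v v) \<bullet>c v) \<le> Re (((?B + ?N * mat_adjoint ?N) *\<^sub>v v) \<bullet>c v)"
      unfolding form_add[OF B(1) NN(1) v] using psd_matD(2)[OF NN(2,1) v] by simp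
  qed
  assume Y: "Y \<in> carrier_mat n r"
    and cover: "\<And>w. w \<in> carrier_vec n \<Longrightarrow> mat_adjoint Q *\<^sub>v w = 0\<^sub>v m \<Longrightarrow>
      \<exists>y \<in> carrier_vec r. w = Y *\<^sub>v y \<and> nsq y \<le> nsq w"
  let ?M = "mat_adjoint S * Y"
  have M: "?M \<in> carrier_mat n r" using aS Y by (rule mult_carrier_mat)
  have "det1 (?N * mat_adjoint ?N) \<le> det1 (?M * mat_adjoint ?M)"
  proof (rule det1_mono[OF NN _ psd_gram(1)[OF M]])
    show "?M * mat_adjoint ?M \<in> carrier_mat n n" by (rule mult_carrier_mat[OF M mat_adjoint_carrier[OF M]])
    fix v :: "complex vec" assume v: "v \<in> carrier_vec n"
    have Sv: "S *\<^sub>v v \<in> carrier_vec n" using S v by (rule mult_mat_vec_carrier)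
    have N': "mat_adjoint ?N *\<^sub>v v = P *\<^sub>v (S *\<^sub>v v)"
      unfolding mat_adjoint_mult[OF aS P] aP using assoc_mult_mat_vec[OF P S v] by simp
    have M': "mat_adjoint ?M *\<^sub>v v = mat_adjoint Y *\<^sub>v (S *\<^sub>v v)"
      unfolding mat_adjoint_mult[OF aS Y] 
      using assoc_mult_mat_vec[OF mat_adjoint_carrier[OF Y] S v] by simp
    show "Re ((?N * mat_adjoint ?N *\<^sub>v v) \<bullet>c v) \<le> Re ((?M * mat_adjoint ?M *\<^sub>v v) \<bullet>c v)"
      unfolding psd_gram(2)[OF N v] psd_gram(2)[OF M v] N' M' unfolding P_def
      by (rule complement_projection_le[OF Q orth Y cover Sv])
  qed
  hence "det1 (?N * mat_adjoint ?N) \<le> det1 (mat_adjoint Y * A * Y)"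
    unfolding gram_eq(2)[OF Y] .
  moreover have "det1 A \<le> det1 (mat_adjoint Q * A * Q) * det1 (?N * mat_adjoint ?N)"
    unfolding detA detT[symmetric] by (rule det1_add_le[OF B N])
  ultimately show "det1 A \<le> det1 (mat_adjoint Q * A * Q) * det1 (mat_adjoint Y * A * Y)"
    using T1 by (meson mult_left_mono order_trans zero_le_one)
qed

section \<open>Real diagonal matrices and their unitary conjugates\<close>

lemma rdiag_carrier [simp]: "rdiag n d \<in> carrier_mat n n"
  by (simp add: rdiag_def)

lemma rdiag_dim [simp]: "dim_row (rdiag n d) = n" "dim_col (rdiag n d) = n"
  by (simp_all add: rdiag_def)

lemma rdiag_adjoint [simp]: "mat_adjoint (rdiag n d) = rdiag n d"
  by (rule eq_matI) (auto simp: rdiag_def)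

lemma rdiag_mult_index:
  "i < n \<Longrightarrow> j < dim_col M \<Longrightarrow> dim_row M = n \<Longrightarrow> (rdiag n d * M) $$ (i,j) = complex_of_real (d i) * M $$ (i,j)"
  by (simp add: mult_mat_index del: index_mult_mat(1))
    (simp add: rdiag_def if_distrib[of "\<lambda>x. x * _"] sum.delta cong: if_cong)

lemma rdiag_mult_vec_index:
  "i < n \<Longrightarrow> dim_vec v = n \<Longrightarrow> (rdiag n d *\<^sub>v v) $ i = complex_of_real (d i) * v $ i"
  by (simp add: mult_vec_index del: index_mult_mat_vec)
    (simp add: rdiag_def if_distrib[of "\<lambda>x. x * _"] sum.delta cong: if_cong)

lemma rdiag_mult: "rdiag n d * rdiag n e = rdiag n (\<lambda>i. d i * e i)"
  by (rule eq_matI) (auto simp: rdiag_mult_index simp del: index_mult_mat(1), auto simp: rdiag_def)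

lemma rdiag_smult: "complex_of_real c \<cdot>\<^sub>m rdiag n d = rdiag n (\<lambda>i. c * d i)"
  by (rule eq_matI) (auto simp: rdiag_def)

lemma rdiag_one: "rdiag n (\<lambda>i. 1) = 1\<^sub>m n"
  by (rule eq_matI) (auto simp: rdiag_def)

lemma rdiag_gram:
  assumes "\<And>i. i < n \<Longrightarrow> 0 \<le> d i"
  shows "rdiag n (\<lambda>i. sqrt (d i)) * mat_adjoint (rdiag n (\<lambda>i. sqrt (d i))) = rdiag n d"
  unfolding rdiag_adjoint rdiag_mult using assms by (intro eq_matI) (auto simp: rdiag_def)

lemma conjugated_mult:
  fixes U :: "complex mat"
  assumes U: "U \<in> carrier_mat n n" "mat_adjoint U * U = 1\<^sub>m n"
    and M: "M \<in> carrier_mat n n" and N: "N \<in> carrier_mat n n"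
  shows "U * M * mat_adjoint U * (U * N * mat_adjoint U) = U * (M * N) * mat_adjoint U"
proof -
  have aU: "mat_adjoint U \<in> carrier_mat n n" using U by simp
  have "mat_adjoint U * (U * (N * mat_adjoint U)) = N * mat_adjoint U"
    using assoc_mult_mat[OF aU U(1) mult_carrier_mat[OF N aU]] U(2)
      left_mult_one_mat[OF mult_carrier_mat[OF N aU]] by simp
  thus ?thesis
    using U(1) aU M N by (simp add: assoc_mult_mat[of _ n n _ n _ n])
qed

lemma conjugated_rdiag_pow:
  fixes U :: "complex mat"
  assumes U: "U \<in> carrier_mat n n" "mat_adjoint U * U = 1\<^sub>m n" "U * mat_adjoint U = 1\<^sub>m n"
  shows "(U * rdiag n d * mat_adjoint U) ^\<^sub>m j = U * rdiag n (\<lambda>i. d i ^ j) * mat_adjoint U"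
proof (induction j)
  case 0
  show ?case using U by (simp add: rdiag_one)
next
  case (Suc j)
  show ?case
    unfolding pow_mat.simps Suc conjugated_mult[OF U(1,2) rdiag_carrier rdiag_carrier] rdiag_mult
    by (simp add: mult.commute)
qed

subsection \<open>Krylov spaces and graph subspaces\<close>

lemma sum_split_at: "(\<Sum>i<k + r. f i) = (\<Sum>i<k. f i) + (\<Sum>j<r. f (j + k :: nat) :: 'a :: comm_monoid_add)"
  by (induction r) (auto simp: ac_simps)

lemma adjoint_mult_vec_index:
  fixes M :: "complex mat"
  assumes "M \<in> carrier_mat n l" "w \<in> carrier_vec n" "c < l"
  shows "(mat_adjoint M *\<^sub>v w) $ c = (\<Sum>i<n. cnj (M $$ (i,c)) * w $ i)"
  using assms by (simp add: mult_vec_index del: index_mult_mat_vec)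

lemma nsq_unitary:
  fixes U :: "complex mat"
  assumes U: "U \<in> carrier_mat n n" "U * mat_adjoint U = 1\<^sub>m n" and w: "w \<in> carrier_vec n"
  shows "U *\<^sub>v (mat_adjoint U *\<^sub>v w) = w" "nsq (mat_adjoint U *\<^sub>v w) = nsq w"
proof -
  have aU: "mat_adjoint U \<in> carrier_mat n n" using U by simp
  have u: "mat_adjoint U *\<^sub>v w \<in> carrier_vec n" using aU w by (rule mult_mat_vec_carrier)
  show *: "U *\<^sub>v (mat_adjoint U *\<^sub>v w) = w"
    using assoc_mult_mat_vec[OF U(1) aU w] U(2) w by simp
  have "complex_of_real (nsq (mat_adjoint U *\<^sub>v w)) = complex_of_real (nsq w)"
    using cscalar_adjoint[OF aU w u] * by (simp add: cscalar_self)
  thus "nsq (mat_adjoint U *\<^sub>v w) = nsq w" by simp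
qed

text \<open>A vector orthogonal to the range of \<open>Q\<close> is orthogonal to all Krylov
  columns, since K^H = R^H Q^H. In eigenvector coordinates, orthogonality to column \<open>c\<close>
  of A^j \<Omega> says that a \<open>j\<close>-th moment over the eigenvalues vanishes, which is
  what \<open>moments_zero_cheb\<close> takes as input.\<close>

lemma krylov_orthogonal_moments:
  fixes U \<Omega> Q R :: "complex mat"
  assumes U: "U \<in> carrier_mat n n" "mat_adjoint U * U = 1\<^sub>m n" "U * mat_adjoint U = 1\<^sub>m n"
    and A: "A = U * rdiag n lam * mat_adjoint U"
    and Om: "\<Omega> \<in> carrier_mat n l"
    and Q: "Q \<in> carrier_mat n (q * l)" and R: "R \<in> carrier_mat (q * l) (q * l)"
    and QR: "krylov A \<Omega> q = Q * R"
    and w: "w \<in> carrier_vec n" and Qw: "mat_adjoint Q *\<^sub>v w = 0\<^sub>v (q * l)"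
    and j: "1 \<le> j" "j \<le> q" and c: "c < l"
  shows "(\<Sum>i<n. cnj ((mat_adjoint U * \<Omega>) $$ (i,c)) * (mat_adjoint U *\<^sub>v w) $ i * complex_of_real (lam i ^ j)) = 0"
proof -
  have aU: "mat_adjoint U \<in> carrier_mat n n" using U by simp
  define H where "H = mat_adjoint U * \<Omega>"
  have H: "H \<in> carrier_mat n l" unfolding H_def using aU Om by (rule mult_carrier_mat)
  define D where "D = rdiag n (\<lambda>i. lam i ^ j)"
  have D: "D \<in> carrier_mat n n" by (simp add: D_def)
  have DH: "D * H \<in> carrier_mat n l" using D H by (rule mult_carrier_mat)
  have Apow: "A ^\<^sub>m j * \<Omega> = U * (D * H)"
    unfolding A conjugated_rdiag_pow[OF U] D_def[symmetric] H_def
    using assoc_mult_mat[OF mult_carrier_mat[OF U(1) D] aU Om] assoc_mult_mat[OF U(1) D H] by (simp add: H_def)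
  have AO: "A ^\<^sub>m j * \<Omega> \<in> carrier_mat n l" unfolding Apow using U(1) DH by (rule mult_carrier_mat)
  define K where "K = krylov A \<Omega> q"
  have K: "K \<in> carrier_mat n (q * l)" unfolding K_def QR using Q R by (rule mult_carrier_mat)
  have dimA: "dim_row A = n" unfolding A using U by simp
  \<comment> \<open>Position of column \<open>c\<close> of A^j \<Omega>: blocks are counted from 0
    while powers start at 1, whence \<open>j - 1\<close>.\<close>
  define p where "p = (j - 1) * l + c"
  have p: "p < q * l" "p div l = j - 1" "p mod l = c"
  proof -
    have "p < (j - 1) * l + l" using c by (simp add: p_def)
    also have "\<dots> = j * l" using j by (cases j) auto
    also have "\<dots> \<le> q * l" using j by simp
    finally show "p < q * l" .
  qed (use c in \<open>simp_all add: p_def\<close>)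
  have Kp: "K $$ (i,p) = (A ^\<^sub>m j * \<Omega>) $$ (i,c)" if "i < n" for i
  proof -
    have "p div l + 1 = j" using p(2) j by simp
    thus ?thesis unfolding K_def krylov_def using that p(1,3) Om dimA by (simp del: pow_mat.simps)
  qed
  have "mat_adjoint K *\<^sub>v w = mat_adjoint R *\<^sub>v (mat_adjoint Q *\<^sub>v w)"
    unfolding K_def QR mat_adjoint_mult[OF Q R]
    by (rule assoc_mult_mat_vec[OF mat_adjoint_carrier[OF R] mat_adjoint_carrier[OF Q] w])
  also have "\<dots> $ p = 0" unfolding Qw using R p by (simp add: mult_vec_index del: index_mult_mat_vec)
  finally have "0 = (\<Sum>i<n. cnj (K $$ (i,p)) * w $ i)"
    using K p w by (simp add: mult_vec_index del: index_mult_mat_vec)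
  also have "\<dots> = (\<Sum>i<n. cnj ((A ^\<^sub>m j * \<Omega>) $$ (i,c)) * w $ i)" using Kp by simp
  also have "\<dots> = (mat_adjoint (A ^\<^sub>m j * \<Omega>) *\<^sub>v w) $ c"
    by (rule adjoint_mult_vec_index[OF AO w c, symmetric])
  also have "mat_adjoint (A ^\<^sub>m j * \<Omega>) *\<^sub>v w = mat_adjoint (D * H) *\<^sub>v (mat_adjoint U *\<^sub>v w)"
    unfolding Apow mat_adjoint_mult[OF U(1) DH]
    by (rule assoc_mult_mat_vec[OF mat_adjoint_carrier[OF DH] aU w])
  also have "\<dots> $ c = (\<Sum>i<n. cnj (H $$ (i,c)) * (mat_adjoint U *\<^sub>v w) $ i * complex_of_real (lam i ^ j))"
  proof -
    define u where "u = mat_adjoint U *\<^sub>v w"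
    have u: "u \<in> carrier_vec n" unfolding u_def by (rule mult_mat_vec_carrier[OF aU w])
    have "(mat_adjoint (D * H) *\<^sub>v u) $ c = (\<Sum>i<n. cnj ((D * H) $$ (i,c)) * u $ i)"
      by (rule adjoint_mult_vec_index[OF DH u c])
    also have "\<dots> = (\<Sum>i<n. cnj (H $$ (i,c)) * u $ i * complex_of_real (lam i ^ j))"
    proof (rule sum.cong)
      fix i assume "i \<in> {..<n}"
      hence "(D * H) $$ (i,c) = complex_of_real (lam i ^ j) * H $$ (i,c)"
        unfolding D_def using c H by (intro rdiag_mult_index) auto
      thus "cnj ((D * H) $$ (i,c)) * u $ i = cnj (H $$ (i,c)) * u $ i * complex_of_real (lam i ^ j)"
        by simp
    qed simp
    finally show ?thesis by (simp add: u_def)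
  qed
  finally show ?thesis by (simp add: H_def)
qed

text \<open>The columns span the orthogonal complement of the range of \<open>(1; F)\<close>.\<close>

definition graph_complement :: "complex mat \<Rightarrow> complex mat" where
  "graph_complement F = mat (dim_col F + dim_row F) (dim_row F)
     (\<lambda>(i,a). if i < dim_col F then - cnj (F $$ (a,i)) else if i - dim_col F = a then 1 else 0)"

lemma graph_complement_carrier: "F \<in> carrier_mat r k \<Longrightarrow> graph_complement F \<in> carrier_mat (k + r) r"
  by (simp add: graph_complement_def)

text \<open>The hypothesis \<open>top\<close> expresses orthogonality to the columns of (1; F). Such
  a vector is fixed by its last \<open>r\<close> entries, which are its coordinates because the
  lower block of \<open>graph_complement F\<close> is the identity.\<close>

lemma graph_complement_mult_vec:
  assumes F: "F \<in> carrier_mat r k" and u: "u \<in> carrier_vec (k + r)"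
    and top: "\<And>i. i < k \<Longrightarrow> u $ i = - (\<Sum>j<r. cnj (F $$ (j,i)) * u $ (j + k))"
  shows "u = graph_complement F *\<^sub>v vec r (\<lambda>j. u $ (j + k))"
proof (rule eq_vecI)
  fix i assume "i < dim_vec (graph_complement F *\<^sub>v vec r (\<lambda>j. u $ (j + k)))"
  hence i: "i < k + r" using F by (simp add: graph_complement_def)
  have "(graph_complement F *\<^sub>v vec r (\<lambda>j. u $ (j + k))) $ i =
      (\<Sum>j<r. graph_complement F $$ (i,j) * u $ (j + k))"
    using F i by (simp add: mult_vec_index graph_complement_def del: index_mult_mat_vec)
  also have "\<dots> = u $ i"
  proof (cases "i < k")
    case True
    have "(\<Sum>j<r. graph_complement F $$ (i,j) * u $ (j + k)) = (\<Sum>j<r. - (cnj (F $$ (j,i)) * u $ (j + k)))"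
      using F i True by (intro sum.cong) (auto simp: graph_complement_def)
    thus ?thesis using top[OF True] by (simp add: sum_negf)
  next
    case False
    have "(\<Sum>j<r. graph_complement F $$ (i,j) * u $ (j + k)) = (\<Sum>j<r. if j = i - k then u $ (j + k) else 0)"
      using F i False by (intro sum.cong) (auto simp: graph_complement_def)
    also have "\<dots> = u $ i" using i False by (subst sum.delta) auto
    finally show ?thesis .
  qed
  finally show "u $ i = (graph_complement F *\<^sub>v vec r (\<lambda>j. u $ (j + k))) $ i" by simp
qed (use F u in \<open>simp add: graph_complement_def\<close>)

text \<open>For Y = (-F^H; 1) the two blocks contribute F \<Lambda>1 F^H and \<Lambda>2. The first
  is written as a Gram matrix, with the square root of \<Lambda>1 absorbed into \<open>M\<close>, to
  suit \<open>det1_add_le\<close> and \<open>det1_scaled_le\<close>.\<close>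

lemma graph_complement_form:
  fixes F :: "complex mat"
  assumes F: "F \<in> carrier_mat r k" and lam: "\<And>i. i < k \<Longrightarrow> 0 \<le> lam i"
  defines "Y \<equiv> graph_complement F" and "M \<equiv> F * rdiag k (\<lambda>i. sqrt (lam i))"
  shows "mat_adjoint Y * rdiag (k + r) lam * Y = M * mat_adjoint M + rdiag r (\<lambda>j. lam (j + k))"
proof (rule eq_matI)
  have M: "M \<in> carrier_mat r k" unfolding M_def using F by (intro mult_carrier_mat) auto
  have Y: "Y \<in> carrier_mat (k + r) r" unfolding Y_def by (rule graph_complement_carrier[OF F])
  have DY: "rdiag (k + r) lam * Y \<in> carrier_mat (k + r) r" using rdiag_carrier Y by (rule mult_carrier_mat)
  show "dim_row (mat_adjoint Y * rdiag (k + r) lam * Y) = dim_row (M * mat_adjoint M + rdiag r (\<lambda>j. lam (j + k)))"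
    "dim_col (mat_adjoint Y * rdiag (k + r) lam * Y) = dim_col (M * mat_adjoint M + rdiag r (\<lambda>j. lam (j + k)))"
    using M Y by auto
  fix a b assume "a < dim_row (M * mat_adjoint M + rdiag r (\<lambda>j. lam (j + k)))"
    "b < dim_col (M * mat_adjoint M + rdiag r (\<lambda>j. lam (j + k)))"
  hence ab: "a < r" "b < r" by auto
  have Mij: "M $$ (a,i) = F $$ (a,i) * complex_of_real (sqrt (lam i))" if "a < r" "i < k" for a i
    unfolding M_def using that F
    by (simp add: mult_mat_index del: index_mult_mat(1))
      (simp add: rdiag_def if_distrib[of "\<lambda>x. _ * x"] sum.delta cong: if_cong)
  have "(mat_adjoint Y * rdiag (k + r) lam * Y) $$ (a,b) = (mat_adjoint Y * (rdiag (k + r) lam * Y)) $$ (a,b)"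
    using assoc_mult_mat[OF mat_adjoint_carrier[OF Y] rdiag_carrier Y] by simp
  also have "\<dots> = (\<Sum>i<k + r. cnj (Y $$ (i,a)) * (complex_of_real (lam i) * Y $$ (i,b)))"
    using Y DY ab by (simp add: mult_mat_index[of a _ b] rdiag_mult_index del: index_mult_mat(1))
  also have "\<dots> = (\<Sum>i<k. cnj (Y $$ (i,a)) * (complex_of_real (lam i) * Y $$ (i,b))) +
      (\<Sum>j<r. cnj (Y $$ (j + k,a)) * (complex_of_real (lam (j + k)) * Y $$ (j + k,b)))"
    by (rule sum_split_at)
  also have "(\<Sum>i<k. cnj (Y $$ (i,a)) * (complex_of_real (lam i) * Y $$ (i,b))) =
      (\<Sum>i<k. M $$ (a,i) * cnj (M $$ (b,i)))"
  proof (rule sum.cong)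
    fix i assume "i \<in> {..<k}"
    hence i: "i < k" by simp
    have "complex_of_real (lam i) = complex_of_real (sqrt (lam i)) * complex_of_real (sqrt (lam i))"
      using lam[OF i] by (simp flip: of_real_mult)
    thus "cnj (Y $$ (i,a)) * (complex_of_real (lam i) * Y $$ (i,b)) = M $$ (a,i) * cnj (M $$ (b,i))"
      using i ab F by (simp add: Mij) (simp add: Y_def graph_complement_def ac_simps)
  qed simp
  also have "\<dots> = (M * mat_adjoint M) $$ (a,b)"
    using M ab by (simp add: mult_mat_index del: index_mult_mat(1))
  also have "(\<Sum>j<r. cnj (Y $$ (j + k,a)) * (complex_of_real (lam (j + k)) * Y $$ (j + k,b))) =
      (\<Sum>j<r. if j = a then (if a = b then complex_of_real (lam (a + k)) else 0) else 0)"
    using F ab by (intro sum.cong) (auto simp: Y_def graph_complement_def)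
  also have "\<dots> = rdiag r (\<lambda>j. lam (j + k)) $$ (a,b)" using ab by (simp add: rdiag_def)
  finally show "(mat_adjoint Y * rdiag (k + r) lam * Y) $$ (a,b) =
      (M * mat_adjoint M + rdiag r (\<lambda>j. lam (j + k))) $$ (a,b)"
    using M ab by simp
qed

lemma nsq_rdiag: "v \<in> carrier_vec n \<Longrightarrow> nsq (rdiag n d *\<^sub>v v) = (\<Sum>i<n. (d i)\<^sup>2 * (cmod (v $ i))\<^sup>2)"
  by (auto simp: nsq_def rdiag_mult_vec_index norm_mult power_mult_distrib simp del: index_mult_mat_vec)

text \<open>Writing M^H = D G^H E and bounding D, G^H and E in turn gives |M^H v|^2 \<le> b |G|^2
  times the sum of c_j |v_j|^2. The bound is the form of the Gram matrix of \<open>?E\<close>, so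
  \<open>det1_mono\<close> applies.\<close>

lemma det1_scaled_le:
  fixes G :: "complex mat"
  assumes G: "G \<in> carrier_mat r k" and b: "0 \<le> b"
    and d: "\<And>i. i < k \<Longrightarrow> (d i)\<^sup>2 \<le> b" and e: "\<And>j. j < r \<Longrightarrow> (e j)\<^sup>2 \<le> c j"
  defines "M \<equiv> rdiag r e * G * rdiag k d"
  shows "det1 (M * mat_adjoint M) \<le> det1 (rdiag r (\<lambda>j. b * (spec_norm G)\<^sup>2 * c j))"
proof -
  let ?E = "rdiag r (\<lambda>j. sqrt (b * (spec_norm G)\<^sup>2 * c j))"
  have c: "0 \<le> c j" if "j < r" for j using e[OF that] by (meson order_trans zero_le_power2)
  have nn: "0 \<le> b * (spec_norm G)\<^sup>2 * c j" if "j < r" for j using b c[OF that] by simp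
  have eG: "rdiag r e * G \<in> carrier_mat r k" using rdiag_carrier G by (rule mult_carrier_mat)
  have M: "M \<in> carrier_mat r k" unfolding M_def using eG rdiag_carrier by (rule mult_carrier_mat)
  have aG: "mat_adjoint G \<in> carrier_mat k r" using G by simp
  have "det1 (M * mat_adjoint M) \<le> det1 (?E * mat_adjoint ?E)"
  proof (rule det1_mono[OF _ psd_gram(1)[OF M] _ psd_gram(1)[OF rdiag_carrier]])
    show "M * mat_adjoint M \<in> carrier_mat r r" "?E * mat_adjoint ?E \<in> carrier_mat r r"
      using mult_carrier_mat[OF M mat_adjoint_carrier[OF M]]
        mult_carrier_mat[OF rdiag_carrier mat_adjoint_carrier[OF rdiag_carrier]] by auto
    fix v :: "complex vec" assume v: "v \<in> carrier_vec r"
    define z where "z = rdiag r e *\<^sub>v v"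
    have z: "z \<in> carrier_vec r" unfolding z_def using rdiag_carrier v by (rule mult_mat_vec_carrier)
    have Gz: "mat_adjoint G *\<^sub>v z \<in> carrier_vec k" using aG z by (rule mult_mat_vec_carrier)
    have "mat_adjoint M *\<^sub>v v = rdiag k d *\<^sub>v (mat_adjoint G *\<^sub>v z)"
      unfolding M_def mat_adjoint_mult[OF eG rdiag_carrier] mat_adjoint_mult[OF rdiag_carrier G] rdiag_adjoint z_def
      using assoc_mult_mat_vec[OF rdiag_carrier mult_carrier_mat[OF aG rdiag_carrier] v]
        assoc_mult_mat_vec[OF aG rdiag_carrier v] by simp
    hence "nsq (mat_adjoint M *\<^sub>v v) = (\<Sum>i<k. (d i)\<^sup>2 * (cmod ((mat_adjoint G *\<^sub>v z) $ i))\<^sup>2)"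
      by (simp only: nsq_rdiag[OF Gz])
    also have "\<dots> \<le> (\<Sum>i<k. b * (cmod ((mat_adjoint G *\<^sub>v z) $ i))\<^sup>2)"
      using d by (intro sum_mono mult_right_mono) auto
    also have "\<dots> = b * nsq (mat_adjoint G *\<^sub>v z)"
      using Gz by (simp only: nsq_def sum_distrib_left carrier_vecD)
    also have "\<dots> \<le> b * ((spec_norm G)\<^sup>2 * nsq z)"
      using b by (intro mult_left_mono spec_norm_adjoint_bound[OF G z])
    also have "nsq z = (\<Sum>j<r. (e j)\<^sup>2 * (cmod (v $ j))\<^sup>2)" unfolding z_def by (rule nsq_rdiag[OF v])
    also have "b * ((spec_norm G)\<^sup>2 * \<dots>) \<le> b * ((spec_norm G)\<^sup>2 * (\<Sum>j<r. c j * (cmod (v $ j))\<^sup>2))"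
      using b e by (intro mult_left_mono sum_mono mult_right_mono) auto
    also have "\<dots> = (\<Sum>j<r. (sqrt (b * (spec_norm G)\<^sup>2 * c j))\<^sup>2 * (cmod (v $ j))\<^sup>2)"
      using nn by (simp add: sum_distrib_left ac_simps)
    also have "\<dots> = nsq (mat_adjoint ?E *\<^sub>v v)" unfolding rdiag_adjoint by (rule nsq_rdiag[OF v, symmetric])
    finally show "Re ((M * mat_adjoint M *\<^sub>v v) \<bullet>c v) \<le> Re ((?E * mat_adjoint ?E *\<^sub>v v) \<bullet>c v)"
      unfolding psd_gram(2)[OF M v] psd_gram(2)[OF rdiag_carrier v] .
  qed
  thus ?thesis using rdiag_gram[of r "\<lambda>j. b * (spec_norm G)\<^sup>2 * c j"] nn by simp
qed

theorem theorem6: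
  fixes A U \<Omega> Q R :: "complex mat" and lam :: "nat \<Rightarrow> real" and n k l q :: nat
  assumes A: "A \<in> carrier_mat n n" and herm: "hermitian_mat A" and psd: "psd_mat A"
    and U: "U \<in> carrier_mat n n" and unit: "unitary_mat U"
    and eig: "A = U * rdiag n lam * mat_adjoint U"
    and sorted: "\<And>i j. i \<le> j \<Longrightarrow> j < n \<Longrightarrow> lam j \<le> lam i"
    and k: "1 \<le> k" "k < n" and gap: "lam (k - 1) > lam k" and pos: "lam k > 0"
    and q: "1 \<le> q" and l: "k \<le> l" "l \<le> n"
    and Om: "\<Omega> \<in> carrier_mat n l"
    and rank1: "vec_space.rank k (mat_adjoint (first_cols U k) * \<Omega>) = k"
    and rankK: "vec_space.rank n (krylov A \<Omega> q) = q * l"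
    and Q: "Q \<in> carrier_mat n (q * l)" and Qorth: "mat_adjoint Q * Q = 1\<^sub>m (q * l)"
    and R: "R \<in> carrier_mat (q * l) (q * l)" and Rtri: "upper_triangular R"
    and QR: "krylov A \<Omega> q = Q * R"
  shows "let T = mat_adjoint Q * A * Q;
             \<Omega>1 = mat_adjoint (first_cols U k) * \<Omega>;
             \<Omega>2 = mat_adjoint (last_cols U k) * \<Omega>;
             \<Lambda>2 = rdiag (n - k) (\<lambda>i. lam (i + k));
             \<eta> = lam k / lam (k - 1) / (cheb (q - 1) ((2 * lam (k - 1) - lam k) / lam k))\<^sup>2
                   * (spec_norm (\<Omega>2 * pinv \<Omega>1))\<^sup>2
         in 0 \<le> logdet_id_plus A - logdet_id_plus T \<and>
            logdet_id_plus A - logdet_id_plus T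
              \<le> logdet_id_plus (complex_of_real \<eta> \<cdot>\<^sub>m \<Lambda>2) + logdet_id_plus \<Lambda>2"
proof -

  \<comment> \<open>Notation, the blocks of U^H \<Omega>, and nonnegativity of the
    eigenvalues\<close>
  define r where "r = n - k"
  have n: "n = k + r" using k by (simp add: r_def)
  \<comment> \<open>Eigenvalues are indexed from 0: \<open>lam (k - 1)\<close> is the smallest of
    the \<open>k\<close> leading ones and \<open>mu = lam k\<close> the largest of the rest.\<close>
  define mu where "mu = lam k"
  define c where "c = cheb (q - 1) ((2 * lam (k - 1) - mu) / mu)"
  \<comment> \<open>A polynomial of degree \<open>q\<close> without constant term, so that \<phi>(A)
    \<Omega> has its columns in the Krylov space. The map from t to (2 t - mu) / mu sends [0, mu]
    onto [-1, 1] and larger eigenvalues beyond 1.\<close>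
  define \<phi> where "\<phi> = (\<lambda>t. t * cheb (q - 1) ((2 * t - mu) / mu))"
  define \<Omega>1 where "\<Omega>1 = mat_adjoint (first_cols U k) * \<Omega>"
  define \<Omega>2 where "\<Omega>2 = mat_adjoint (last_cols U k) * \<Omega>"
  define X where "X = pinv \<Omega>1"
  define G where "G = \<Omega>2 * X"
  define H where "H = mat_adjoint U * \<Omega>"
  have mu: "0 < mu" using pos by (simp add: mu_def)
  have aU: "mat_adjoint U \<in> carrier_mat n n" using U by simp
  have UU: "mat_adjoint U * U = 1\<^sub>m n" "U * mat_adjoint U = 1\<^sub>m n"
    using unit U by (auto simp: unitary_mat_def)
  have H: "H \<in> carrier_mat n l" unfolding H_def using aU Om by (rule mult_carrier_mat)
  have O1: "\<Omega>1 \<in> carrier_mat k l" unfolding \<Omega>1_def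
    by (rule mult_carrier_mat[OF mat_adjoint_carrier Om]) (use U in \<open>simp add: first_cols_def\<close>)
  have O2: "\<Omega>2 \<in> carrier_mat r l" unfolding \<Omega>2_def
    by (rule mult_carrier_mat[OF mat_adjoint_carrier Om]) (use U in \<open>simp add: last_cols_def r_def\<close>)
  have X: "X \<in> carrier_mat l k" "\<Omega>1 * X = 1\<^sub>m k"
    unfolding X_def using pinv_full_row_rank[OF O1] rank1 by (simp_all add: \<Omega>1_def)
  have G: "G \<in> carrier_mat r k" unfolding G_def using O2 X(1) by (rule mult_carrier_mat)
  have O1H: "\<Omega>1 $$ (i,b) = H $$ (i,b)" if "i < k" "b < l" for i b
    unfolding \<Omega>1_def H_def using that U Om n
    by (simp add: mult_mat_index first_cols_def del: index_mult_mat(1))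
  have O2H: "\<Omega>2 $$ (j,b) = H $$ (j + k,b)" if "j < r" "b < l" for j b
    unfolding \<Omega>2_def H_def using that U Om n
    by (simp add: mult_mat_index last_cols_def del: index_mult_mat(1))

  \<comment> \<open>Positivity of \<open>A\<close> is tested on the unit eigenvector U e_i.\<close>
  have lam_nonneg: "0 \<le> lam i" if i: "i < n" for i
  proof -
    have e: "unit_vec n i \<in> carrier_vec n" by simp
    have Ue: "U *\<^sub>v unit_vec n i \<in> carrier_vec n" using U e by (rule mult_mat_vec_carrier)
    have aUU: "mat_adjoint U *\<^sub>v (U *\<^sub>v unit_vec n i) = unit_vec n i"
      using assoc_mult_mat_vec[OF aU U e] UU(1) by simp
    have De: "rdiag n lam *\<^sub>v unit_vec n i = complex_of_real (lam i) \<cdot>\<^sub>v unit_vec n i"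
      by (rule eq_vecI) (auto simp: rdiag_mult_vec_index unit_vec_def simp del: index_mult_mat_vec)
    have "A *\<^sub>v (U *\<^sub>v unit_vec n i) = U *\<^sub>v (rdiag n lam *\<^sub>v unit_vec n i)"
      unfolding eig using assoc_mult_mat_vec[OF mult_carrier_mat[OF U rdiag_carrier] aU Ue]
        assoc_mult_mat_vec[OF U rdiag_carrier e] aUU by simp
    also have "\<dots> = complex_of_real (lam i) \<cdot>\<^sub>v (U *\<^sub>v unit_vec n i)"
      unfolding De using U e by (rule mult_mat_vec)
    finally have "0 \<le> Re (complex_of_real (lam i) * ((U *\<^sub>v unit_vec n i) \<bullet>c (U *\<^sub>v unit_vec n i)))"
      using psd_matD(2)[OF psd A Ue] Ue by simp
    moreover have "(U *\<^sub>v unit_vec n i) \<bullet>c (U *\<^sub>v unit_vec n i) = 1"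
      unfolding cscalar_adjoint[OF U e Ue] aUU using i by (simp add: cscalar_sum[of _ n] sum.delta unit_vec_def if_distrib cong: if_cong)
    ultimately show ?thesis by simp
  qed

  \<comment> \<open>Chebyshev estimates on the two parts of the spectrum\<close>
  have arg_ge: "1 \<le> (2 * lam (k - 1) - mu) / mu"
    using gap mu by (simp add: mu_def field_simps)
  have c1: "1 \<le> c" unfolding c_def by (rule cheb_mono(1)[OF arg_ge order_refl])
  have lam_k1: "0 < lam (k - 1)" using gap pos by simp
  \<comment> \<open>\<phi>(t)^2 / t is t times the squared Chebyshev factor, and both are smallest
    at \<open>lam (k - 1)\<close>. Positivity of \<phi> permits the division in
    \<open>F\<close>.\<close>
  have head: "lam (k - 1) * c\<^sup>2 * lam i \<le> (\<phi> (lam i))\<^sup>2" "0 < \<phi> (lam i)" "0 < lam i" if i: "i < k" for i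
  proof -
    have le: "lam (k - 1) \<le> lam i" using sorted[of i "k - 1"] i k by simp
    thus pos_i: "0 < lam i" using lam_k1 by simp
    have "c \<le> cheb (q - 1) ((2 * lam i - mu) / mu)" unfolding c_def
      using arg_ge by (rule cheb_mono(2)) (use le mu in \<open>simp add: divide_right_mono\<close>)
    hence cc: "0 < cheb (q - 1) ((2 * lam i - mu) / mu)" "c\<^sup>2 \<le> (cheb (q - 1) ((2 * lam i - mu) / mu))\<^sup>2"
      using c1 by (auto intro: power_mono)
    show "0 < \<phi> (lam i)" unfolding \<phi>_def using pos_i cc by simp
    have "lam (k - 1) * c\<^sup>2 * lam i \<le> lam i * (cheb (q - 1) ((2 * lam i - mu) / mu))\<^sup>2 * lam i"
      using le cc pos_i lam_k1 by (intro mult_right_mono mult_mono) auto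
    thus "lam (k - 1) * c\<^sup>2 * lam i \<le> (\<phi> (lam i))\<^sup>2" by (simp add: \<phi>_def power2_eq_square ac_simps)
  qed
  \<comment> \<open>On [0, mu] the Chebyshev factor is at most 1 in modulus, so \<phi>(t)^2 \<le>
    t^2 \<le> mu t. The factor t that is kept produces \<Lambda>2 in the final bound.\<close>
  have tail: "(\<phi> (lam (j + k)))\<^sup>2 \<le> mu * lam (j + k)" if j: "j < r" for j
  proof -
    have l0: "0 \<le> lam (j + k)" "lam (j + k) \<le> mu"
      using lam_nonneg[of "j + k"] sorted[of k "j + k"] j n by (auto simp: mu_def)
    hence "\<bar>(2 * lam (j + k) - mu) / mu\<bar> \<le> 1" using mu by (simp add: abs_le_iff field_simps)
    hence "\<bar>cheb (q - 1) ((2 * lam (j + k) - mu) / mu)\<bar> \<le> 1" by (rule abs_cheb_le_1)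
    hence "(cheb (q - 1) ((2 * lam (j + k) - mu) / mu))\<^sup>2 \<le> 1" by (simp add: abs_square_le_1)
    hence "(lam (j + k))\<^sup>2 * (cheb (q - 1) ((2 * lam (j + k) - mu) / mu))\<^sup>2 \<le> (lam (j + k))\<^sup>2 * 1"
      by (intro mult_left_mono) auto
    also have "\<dots> \<le> mu * lam (j + k)" using l0 by (simp add: power2_eq_square mult_right_mono)
    finally show ?thesis by (simp add: \<phi>_def power_mult_distrib)
  qed

  \<comment> \<open>Covering the orthogonal complement of the range of \<open>Q\<close>\<close>
  define F where "F = rdiag r (\<lambda>j. \<phi> (lam (j + k))) * G * rdiag k (\<lambda>i. 1 / \<phi> (lam i))"
  have EG: "rdiag r (\<lambda>j. \<phi> (lam (j + k))) * G \<in> carrier_mat r k"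
    using rdiag_carrier G by (rule mult_carrier_mat)
  have F: "F \<in> carrier_mat r k" unfolding F_def using EG rdiag_carrier by (rule mult_carrier_mat)
  have F_index: "F $$ (j,i) = complex_of_real (\<phi> (lam (j + k)) / \<phi> (lam i)) * G $$ (j,i)" if "j < r" "i < k" for i j
  proof -
    have "F $$ (j,i) = (\<Sum>h<k. (rdiag r (\<lambda>j. \<phi> (lam (j + k))) * G) $$ (j,h) * rdiag k (\<lambda>i. 1 / \<phi> (lam i)) $$ (h,i))"
      unfolding F_def using that EG G by (subst mult_mat_index) auto
    also have "\<dots> = (\<Sum>h<k. if h = i then (rdiag r (\<lambda>j. \<phi> (lam (j + k))) * G) $$ (j,i) * complex_of_real (1 / \<phi> (lam i)) else 0)"
      using that by (intro sum.cong) (auto simp: rdiag_def)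
    also have "\<dots> = (rdiag r (\<lambda>j. \<phi> (lam (j + k))) * G) $$ (j,i) * complex_of_real (1 / \<phi> (lam i))"
      using that by simp
    also have "(rdiag r (\<lambda>j. \<phi> (lam (j + k))) * G) $$ (j,i) = complex_of_real (\<phi> (lam (j + k))) * G $$ (j,i)"
      using that G by (intro rdiag_mult_index) auto
    finally show ?thesis by simp
  qed
  define Y where "Y = U * graph_complement F"
  have gcF: "graph_complement F \<in> carrier_mat n r" unfolding n by (rule graph_complement_carrier[OF F])
  have Y: "Y \<in> carrier_mat n r" unfolding Y_def using U gcF by (rule mult_carrier_mat)

  \<comment> \<open>That the range of \<open>Q\<close> contains the columns of U (1; F) is used in
    dual form: if \<open>w\<close> is orthogonal to \<open>Q\<close>, then u = U^H w is orthogonal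
    to (1; F). The vector \<open>y\<close> is the tail of \<open>u\<close>, hence no longer than
    \<open>w\<close>.\<close>
  have cover: "\<exists>y \<in> carrier_vec r. w = Y *\<^sub>v y \<and> nsq y \<le> nsq w"
    if w: "w \<in> carrier_vec n" "mat_adjoint Q *\<^sub>v w = 0\<^sub>v (q * l)" for w
  proof -
    define u where "u = mat_adjoint U *\<^sub>v w"
    define y where "y = vec r (\<lambda>j. u $ (j + k))"
    have u: "u \<in> carrier_vec n" unfolding u_def using aU w(1) by (rule mult_mat_vec_carrier)
    \<comment> \<open>The exponent 1 and the Chebyshev degree \<open>q - 1\<close> add up to exactly
      \<open>q\<close>, the highest Krylov power.\<close>
    have moment: "(\<Sum>i<n. cnj (H $$ (i,b)) * u $ i * complex_of_real (\<phi> (lam i))) = 0" if b: "b < l" for b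
      using moments_zero_cheb[where c = "\<lambda>i. cnj (H $$ (i,b)) * u $ i" and lam = lam and q = q and n = n
          and a = 1 and m = "q - 1" and mu = mu]
        krylov_orthogonal_moments[OF U UU eig Om Q R QR w _ _ b] mu q
      by (simp add: \<phi>_def H_def u_def)
    have split: "(\<Sum>i<k. cnj (\<Omega>1 $$ (i,b)) * (complex_of_real (\<phi> (lam i)) * u $ i)) +
        (\<Sum>j<r. cnj (\<Omega>2 $$ (j,b)) * (complex_of_real (\<phi> (lam (j + k))) * u $ (j + k))) = 0" if b: "b < l" for b
      using moment[OF b] b unfolding n sum_split_at by (simp add: O1H O2H ac_simps)
    have top: "u $ i = - (\<Sum>j<r. cnj (F $$ (j,i)) * u $ (j + k))" if i: "i < k" for i
    proof -
      have swap: "(\<Sum>b<l. cnj (X $$ (b,i)) * (\<Sum>h<s. cnj (W $$ (h,b)) * f h)) = (\<Sum>h<s. cnj ((W * X) $$ (h,i)) * f h)"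
        if "W \<in> carrier_mat s l" for W s and f :: "nat \<Rightarrow> complex"
      proof -
        have "(\<Sum>b<l. cnj (X $$ (b,i)) * (\<Sum>h<s. cnj (W $$ (h,b)) * f h)) =
            (\<Sum>h<s. \<Sum>b<l. cnj (X $$ (b,i)) * (cnj (W $$ (h,b)) * f h))"
          unfolding sum_distrib_left by (rule sum.swap)
        also have "\<dots> = (\<Sum>h<s. cnj ((W * X) $$ (h,i)) * f h)"
          using that X(1) i by (intro sum.cong)
            (auto simp: mult_mat_index sum_distrib_left ac_simps simp del: index_mult_mat(1))
        finally show ?thesis .
      qed
      \<comment> \<open>Combining the \<open>l\<close> equations with the conjugated entries of
        column \<open>i\<close> of \<open>X\<close> multiplies \<Omega>1 and \<Omega>2 by
        \<open>X\<close>: the first becomes the identity and isolates \<open>u $ i\<close>, the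
        second becomes \<open>G\<close>.\<close>
      have "0 = (\<Sum>b<l. cnj (X $$ (b,i)) * ((\<Sum>i<k. cnj (\<Omega>1 $$ (i,b)) * (complex_of_real (\<phi> (lam i)) * u $ i)) +
        (\<Sum>j<r. cnj (\<Omega>2 $$ (j,b)) * (complex_of_real (\<phi> (lam (j + k))) * u $ (j + k)))))"
        by (simp add: split)
      also have "\<dots> = (\<Sum>h<k. cnj ((\<Omega>1 * X) $$ (h,i)) * (complex_of_real (\<phi> (lam h)) * u $ h)) +
          (\<Sum>j<r. cnj (G $$ (j,i)) * (complex_of_real (\<phi> (lam (j + k))) * u $ (j + k)))"
        unfolding distrib_left sum.distrib swap[OF O1] swap[OF O2] G_def ..
      also have "(\<Sum>h<k. cnj ((\<Omega>1 * X) $$ (h,i)) * (complex_of_real (\<phi> (lam h)) * u $ h)) =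
          (\<Sum>h<k. if h = i then complex_of_real (\<phi> (lam i)) * u $ i else 0)"
        unfolding X(2) using i by (intro sum.cong) auto
      also have "\<dots> = complex_of_real (\<phi> (lam i)) * u $ i" using i by simp
      finally have eq: "complex_of_real (\<phi> (lam i)) * u $ i =
          - (\<Sum>j<r. cnj (G $$ (j,i)) * (complex_of_real (\<phi> (lam (j + k))) * u $ (j + k)))"
        by (simp add: eq_neg_iff_add_eq_0)
      have nz: "complex_of_real (\<phi> (lam i)) \<noteq> 0" using head(2)[OF i] by simp
      have "complex_of_real (\<phi> (lam i)) * (- (\<Sum>j<r. cnj (F $$ (j,i)) * u $ (j + k))) =
          complex_of_real (\<phi> (lam i)) * u $ i"
        unfolding eq using i nz by (simp add: F_index sum_distrib_left ac_simps)
      thus ?thesis using nz by (metis mult_cancel_left)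
    qed
    have "u = graph_complement F *\<^sub>v y"
      unfolding y_def using F u[unfolded n] top by (rule graph_complement_mult_vec)
    moreover have y: "y \<in> carrier_vec r" by (simp add: y_def)
    ultimately have "w = Y *\<^sub>v y"
      unfolding Y_def using nsq_unitary(1)[OF U UU(2) w(1)] assoc_mult_mat_vec[OF U gcF y] by (simp add: u_def)
    moreover have "nsq y \<le> nsq u"
    proof -
      have "nsq u = (\<Sum>i<k + r. (cmod (u $ i))\<^sup>2)" using u by (simp add: nsq_def n)
      also have "\<dots> = (\<Sum>i<k. (cmod (u $ i))\<^sup>2) + nsq y"
        unfolding sum_split_at by (simp add: nsq_def y_def)
      finally show ?thesis by (simp add: sum_nonneg)
    qed
    moreover have "nsq u = nsq w" unfolding u_def by (rule nsq_unitary(2)[OF U UU(2) w(1)])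
    ultimately show ?thesis using y by auto
  qed

  \<comment> \<open>Factorization of \<open>A\<close> and its compression to the range of
    \<open>Q\<close>\<close>
  define S where "S = U * rdiag n (\<lambda>i. sqrt (lam i))"
  have S: "S \<in> carrier_mat n n" unfolding S_def using U rdiag_carrier by (rule mult_carrier_mat)
  have AS: "A = S * mat_adjoint S"
  proof -
    define D where "D = rdiag n (\<lambda>i. sqrt (lam i))"
    have D: "D \<in> carrier_mat n n" by (simp add: D_def)
    have "S * mat_adjoint S = U * D * (D * mat_adjoint U)"
      unfolding S_def D_def mat_adjoint_mult[OF U rdiag_carrier] by simp
    also have "\<dots> = U * (D * D) * mat_adjoint U"
      using assoc_mult_mat[OF U D mult_carrier_mat[OF D aU]] assoc_mult_mat[OF D D aU]
        assoc_mult_mat[OF U mult_carrier_mat[OF D D] aU] by simp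
    also have "D * D = rdiag n lam"
      using rdiag_gram[of n lam] lam_nonneg by (simp add: D_def)
    finally show ?thesis unfolding eig by simp
  qed
  let ?T = "mat_adjoint Q * A * Q"
  have T: "1 \<le> det1 ?T" "det1 ?T \<le> det1 A"
    "det1 A \<le> det1 ?T * det1 (mat_adjoint Y * A * Y)"
    using det1_compression[OF S Q Qorth] Y cover unfolding AS by blast+

  \<comment> \<open>Bounding det (1 + Y^H A Y)\<close>
  let ?gc = "graph_complement F"
  have YAY: "mat_adjoint Y * A * Y = mat_adjoint ?gc * rdiag n lam * ?gc"
  proof -
    have agc: "mat_adjoint ?gc \<in> carrier_mat r n" using gcF by simp
    have UY: "mat_adjoint U * Y = ?gc"
      unfolding Y_def using assoc_mult_mat[OF aU U gcF] UU(1) left_mult_one_mat[OF gcF] by simp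
    have YU: "mat_adjoint Y * U = mat_adjoint ?gc"
      unfolding UY[symmetric] mat_adjoint_mult[OF aU Y] by simp
    have aY: "mat_adjoint Y \<in> carrier_mat r n" using Y by simp
    have "mat_adjoint Y * A = mat_adjoint Y * U * (rdiag n lam * mat_adjoint U)"
      unfolding eig using assoc_mult_mat[OF U rdiag_carrier aU]
        assoc_mult_mat[OF aY U mult_carrier_mat[OF rdiag_carrier aU]] by simp
    hence "mat_adjoint Y * A * Y = mat_adjoint ?gc * (rdiag n lam * mat_adjoint U) * Y"
      unfolding YU by simp
    also have "\<dots> = mat_adjoint ?gc * rdiag n lam * (mat_adjoint U * Y)"
      using agc aU Y assoc_mult_mat[OF agc rdiag_carrier aU]
        assoc_mult_mat[OF mult_carrier_mat[OF agc rdiag_carrier] aU Y] by metis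
    finally show ?thesis unfolding UY .
  qed
  \<comment> \<open>By \<open>head\<close>, \<open>b\<close> bounds lam i / \<phi>(lam i)^2 for the
    leading eigenvalues; \<open>b * mu\<close> times the squared norm of \<open>G\<close> is
    \<eta>.\<close>
  define b where "b = 1 / (lam (k - 1) * c\<^sup>2)"
  have b0: "0 \<le> b" using lam_k1 by (simp add: b_def)
  define \<eta> where "\<eta> = lam k / lam (k - 1) / c\<^sup>2 * (spec_norm G)\<^sup>2"
  let ?L2 = "rdiag r (\<lambda>j. lam (j + k))"
  let ?d = "\<lambda>i. sqrt (lam i) / \<phi> (lam i)"
  \<comment> \<open>The square root of \<Lambda>1 merges with the inverse of \<phi>(\<Lambda>1), so
    that F \<Lambda>1 F^H is the Gram matrix of \<open>?M\<close>.\<close>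
  let ?M = "rdiag r (\<lambda>j. \<phi> (lam (j + k))) * G * rdiag k ?d"
  have lam2: "0 \<le> lam (j + k)" if "j < r" for j using lam_nonneg[of "j + k"] that n by simp
  have M: "?M \<in> carrier_mat r k" using EG rdiag_carrier by (rule mult_carrier_mat)
  have FM: "F * rdiag k (\<lambda>i. sqrt (lam i)) = ?M"
    unfolding F_def assoc_mult_mat[OF EG rdiag_carrier rdiag_carrier] rdiag_mult by simp
  have form: "mat_adjoint Y * A * Y = ?M * mat_adjoint ?M + ?L2"
    unfolding YAY unfolding n FM[symmetric]
    by (rule graph_complement_form[OF F]) (use lam_nonneg n in auto)
  have L2: "?L2 = rdiag r (\<lambda>j. sqrt (lam (j + k))) * mat_adjoint (rdiag r (\<lambda>j. sqrt (lam (j + k))))"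
    using rdiag_gram[of r "\<lambda>j. lam (j + k)"] lam2 by simp
  have "det1 (mat_adjoint Y * A * Y) \<le> det1 (?M * mat_adjoint ?M) * det1 ?L2"
    unfolding form unfolding L2
    by (rule det1_add_le[OF mult_carrier_mat[OF M mat_adjoint_carrier[OF M]] psd_gram(1)[OF M] rdiag_carrier])
  moreover have "det1 (?M * mat_adjoint ?M) \<le> det1 (rdiag r (\<lambda>j. b * (spec_norm G)\<^sup>2 * (mu * lam (j + k))))"
  proof (rule det1_scaled_le[OF G b0 _ tail])
    fix i assume i: "i < k"
    have "(?d i)\<^sup>2 = lam i / (\<phi> (lam i))\<^sup>2" using head(3)[OF i] by (simp add: power_divide)
    also have "\<dots> \<le> b" unfolding b_def
      using head[OF i] lam_k1 c1 by (simp add: field_simps)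
    finally show "(?d i)\<^sup>2 \<le> b" .
  qed
  moreover have "(\<lambda>j. b * (spec_norm G)\<^sup>2 * (mu * lam (j + k))) = (\<lambda>j. \<eta> * lam (j + k))"
    by (simp add: b_def \<eta>_def mu_def fun_eq_iff)
  \<comment> \<open>Lower bounds by 1 allow inequalities to be multiplied and keep the arguments of
    \<open>ln\<close> positive; the one for \<eta> \<Lambda>2 is inherited from the Gram matrix of
    \<open>?M\<close>.\<close>
  moreover have L2_ge: "1 \<le> det1 ?L2"
    unfolding L2 using det_one_plus_psd(2)[OF mult_carrier_mat[OF rdiag_carrier mat_adjoint_carrier[OF rdiag_carrier]] psd_gram(1)[OF rdiag_carrier]] .
  moreover have MM_ge: "1 \<le> det1 (?M * mat_adjoint ?M)"
    using det_one_plus_psd(2)[OF mult_carrier_mat[OF M mat_adjoint_carrier[OF M]] psd_gram(1)[OF M]] .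
  ultimately have eta_ge: "1 \<le> det1 (complex_of_real \<eta> \<cdot>\<^sub>m ?L2)"
    and YAY_le: "det1 (mat_adjoint Y * A * Y) \<le> det1 (complex_of_real \<eta> \<cdot>\<^sub>m ?L2) * det1 ?L2"
    unfolding rdiag_smult by (auto intro: order_trans mult_right_mono)

  \<comment> \<open>Passing to logarithms\<close>
  have "det1 A \<le> det1 ?T * (det1 (complex_of_real \<eta> \<cdot>\<^sub>m ?L2) * det1 ?L2)"
    using T(1,3) YAY_le by (meson mult_left_mono order_trans zero_le_one)
  hence "ln (det1 A) \<le> ln (det1 ?T * (det1 (complex_of_real \<eta> \<cdot>\<^sub>m ?L2) * det1 ?L2))"
    using T(1,2) by (intro ln_mono) auto
  also have "\<dots> = ln (det1 ?T) + (ln (det1 (complex_of_real \<eta> \<cdot>\<^sub>m ?L2)) + ln (det1 ?L2))"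
    using T(1) eta_ge L2_ge by (simp add: ln_mult)
  finally have "logdet_id_plus A - logdet_id_plus ?T
      \<le> logdet_id_plus (complex_of_real \<eta> \<cdot>\<^sub>m ?L2) + logdet_id_plus ?L2"
    by (simp add: logdet_id_plus_eq)
  moreover have "0 \<le> logdet_id_plus A - logdet_id_plus ?T"
    using T(1,2) by (simp add: logdet_id_plus_eq)
  ultimately show ?thesis
    unfolding Let_def \<eta>_def c_def mu_def G_def X_def \<Omega>1_def \<Omega>2_def r_def by blast
qed

end
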